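(* For every integer $m\ge 12$, $$z_{\mathrm{RL}}(m,5)=3m+5 .$$ Moreover, the configuration $K_{m-12}$ (the configuration $K_t$ on the $m\times 5$ grid with $t=m-12$, defined in the context) is an extremal witness, i.e. it is a simple limited configuration satisfying $(\mathrm{RW3}^+)$ with $|E_1|+|E_2|=3m+5$, and it has $|E_1|=m+10$, $|E_2|=2m-5$ and $H=0$.
   Context: **Augmented configurations.** Cells of the $m\times5$ grid are pairs $(r,c)$, $1\le r\le m$, $1\le c\le5$. An augmented configuration consists of a set $E_1$ of cells (one-edges) and a set $E_2$ of unordered pairs of distinct cells (selected two-edges; the two cells are the halves of the two-edge). Each cell contains at most one edge element, i.e. it is a one-edge, or one half of exactly one selected two-edge, or unoccupied (a hole); in particular supports of distinct edge elements are disjoint. $H$ is the number of unoccupied cells. The configuration is simple if it satisfies this disjointness and the one-edge graph (the bipartite graph between rows and columns with edge set $E_1$) is $C_4$-free, i.e. there are no distinct rows $r,s$ and distinct columns $c,d$ with all four cells $(r,c),(r,d),(s,c),(s,d)$ in $E_1$. It is limited if $|E_1|=z(m,5)$, where $z(m,5)$ is the ordinary Zarankiewicz number (maximum number of edges of a $C_4$-free bipartite graph with parts of sizes $m$ and $5$); $z(m,5)=m+10$ for $m\ge10$. The edge elements (labels) are the one-edges and the selected two-edges. The cells of an edge element (one cell for a one-edge, two for a two-edge) are its representatives. **Certificates.** To each occupied cell $p$ associate a formal unit vector $v_p$, and put $v_p=0$ for unoccupied $p$. For distinct cells $p,q$ let $\delta(p,q)=1$ if $\{p,q\}\in E_2$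 and $\delta(p,q)=0$ otherwise. The certified relations are the statements $\langle v_p,v_q\rangle=\text{(value)}$ (symmetric in $p,q$) obtainable in finitely many steps by: - Unit/hole: $\langle v_p,v_p\rangle=1$ for occupied $p$; $\langle v_p,v_q\rangle=0$ if $p$ or $q$ is unoccupied. - Line rule: if $p\ne q$ lie in a common row or a common column, then $\langle v_p,v_q\rangle=\delta(p,q)$. - Rectangle rule: for distinct rows and distinct columns forming a genuine $2\times2$ rectangle with diagonals $\{p,q\}$ and $\{r,s\}$, one has $\langle v_p,v_q\rangle+\langle v_r,v_s\rangle=\delta(p,q)+\delta(r,s)$; so if the value of one diagonal is certified, the value of the other one given by this identity is certified. - Complementary-pair rule: if both diagonals of a genuine rectangle are selected two-edges, then both diagonals are certified to have value $1$. - Saturation: if $\langle v_p,v_{p'}\rangle=1$ is certified, then $p$ and $p'$ may be interchanged in any certified relation. Write $p\sim q$ if $\langle v_p,v_q\rangle=1$ is certified and $p\perp_R q$ if $\langle v_p,v_q\rangle=0$ is certified. **$(\mathrm{RW3}^+)$.** A simple configuration satisfies $(\mathrm{RW3}^+)$ if: (1) $p\sim q$ for every $\{p,q\}\in E_2$; (2) distinct selected two-edges remain in distinct equivalence classes of $\sim$; (3) any two distinct edge elements have certified orthogonal representatives (some cell of one and some cell of the other, hence after (1) all of them, satisfy $\perp_R$). **$z_{\mathrm{RL}}$.** $z_{\mathrm{RL}}(m,5)$ is the maximum of $|E_1|+|E_2|$ over all simple limited configurations on the $m\times5$ grid satisfying $(\mathrm{RW3}^+)$. **Seed $K_0$** ($12\times5$).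 Below $\bullet$ is a one-edge (each $\bullet$ a different one), and the two occurrences of an integer $j$ are the two halves of the selected two-edge $b_j$, $1\le j\le19$: $$\begin{array}{c|ccccc} &1&2&3&4&5\\\hline 1 & \bullet & \bullet & 4 & 3 & 4 \\ 2 & \bullet & 5 & \bullet & 13 & 6 \\ 3 & \bullet & 13 & 19 & \bullet & 1 \\ 4 & \bullet & 7 & 18 & 7 & \bullet \\ 5 & 2 & \bullet & \bullet & 2 & 1 \\ 6 & 18 & \bullet & 17 & \bullet & 19 \\ 7 & 15 & \bullet & 16 & 17 & \bullet \\ 8 & 12 & 6 & \bullet & \bullet & 5 \\ 9 & 14 & 15 & \bullet & 3 & \bullet \\ 10 & 11 & 8 & 9 & \bullet & \bullet \\ 11 & 10 & 9 & 8 & \bullet & 12 \\ 12 & 10 & 14 & 11 & 16 & \bullet \end{array}$$ **Configuration $K_t$** ($t\ge0$, $m=12+t$). For $t=0$ it is $K_0$. For $t\ge1$ put $r_i=11+i$ ($1\le i\le t$), $w=12+t$. Rows $1,\dots,11$ are those of $K_0$, except that the two-edges $b_{14},b_{16}$ are removed and the cells $(9,1)$ and $(7,3)$ now carry halves of new two-edges $P_0$ and $Q_0$. Row $r_i$ is $(P_i,P_{i-1},Q_i,Q_{i-1},U_i)$ and row $w$ is $(b_{10},P_t,b_{11},Q_t,W)$, in columns $1,\dots,5$. Here $U_1,\dots,U_t$ and $W$ are one-edges; $b_{10}=\{(11,1),(w,1)\}$, $b_{11}=\{(10,1),(w,3)\}$; and the selected two-edges $P_j,Q_j$ ($0\le j\le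 t$) each consist of the two cells carrying that label: $P_0=\{(9,1),(r_1,2)\}$, $Q_0=\{(7,3),(r_1,4)\}$, $P_i=\{(r_i,1),(r_{i+1},2)\}$, $Q_i=\{(r_i,3),(r_{i+1},4)\}$ for $1\le i<t$, $P_t=\{(r_t,1),(w,2)\}$, $Q_t=\{(r_t,3),(w,4)\}$. All other two-edges and one-edges are as in $K_0$. *)

theory Defs
  imports Main
begin

section \<open>Grids and augmented configurations\<close>

type_synonym cell = "nat \<times> nat"

definition grid :: "nat \<Rightarrow> nat \<Rightarrow> cell set" where
  "grid m n = {1..m} \<times> {1..n}"

record aug_config =
  one_edges :: "cell set"
  two_edges :: "cell set set"

definition occupied :: "aug_config \<Rightarrow> cell set" where
  "occupied C = one_edges C \<union> \<Union>(two_edges C)"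

definition holes :: "nat \<Rightarrow> nat \<Rightarrow> aug_config \<Rightarrow> cell set" where
  "holes m n C = grid m n - occupied C"

definition augmented :: "nat \<Rightarrow> nat \<Rightarrow> aug_config \<Rightarrow> bool" where
  "augmented m n C \<longleftrightarrow>
     one_edges C \<subseteq> grid m n \<and>
     (\<forall>e\<in>two_edges C. e \<subseteq> grid m n \<and> card e = 2) \<and>
     (\<forall>e\<in>two_edges C. one_edges C \<inter> e = {}) \<and>
     (\<forall>e\<in>two_edges C. \<forall>f\<in>two_edges C. e \<noteq> f \<longrightarrow> e \<inter> f = {})"

text \<open>
  A set of cells is read as the edge set of a bipartite graph between rows and columns.
\<close>

definition C4_free :: "cell set \<Rightarrow> bool" where
  "C4_free E \<longleftrightarrow>
     \<not> (\<exists>r s c d. r \<noteq> s \<and> c \<noteq> d \<and> (r, c) \<in> E \<and> (r, d) \<in> E \<and> (s, c) \<in> E \<and> (s, d) \<in> E)"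

definition zarankiewicz :: "nat \<Rightarrow> nat \<Rightarrow> nat" where
  "zarankiewicz m n = Max {card E | E. E \<subseteq> grid m n \<and> C4_free E}"

definition simple_config :: "nat \<Rightarrow> nat \<Rightarrow> aug_config \<Rightarrow> bool" where
  "simple_config m n C \<longleftrightarrow> augmented m n C \<and> C4_free (one_edges C)"

definition limited :: "nat \<Rightarrow> nat \<Rightarrow> aug_config \<Rightarrow> bool" where
  "limited m n C \<longleftrightarrow> card (one_edges C) = zarankiewicz m n"

text \<open>Edge elements are represented by their supports (their sets of representatives).\<close>

definition edge_elements :: "aug_config \<Rightarrow> cell set set" where
  "edge_elements C = (\<lambda>p. {p}) ` one_edges C \<union> two_edges C"

section \<open>Certified relations\<close>

definition delta :: "aug_config \<Rightarrow> cell \<Rightarrow> cell \<Rightarrow> int" where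
  "delta C p q = (if {p, q} \<in> two_edges C then 1 else 0)"

text \<open>
  \<open>cert m n C p q a\<close> means that the statement \<open>\<langle>v\<^sub>p, v\<^sub>q\<rangle> = a\<close> is certified. Every rule
  yields an integer when its premises do, so integer values suffice.
  In \<open>rectangle\<close> and \<open>complementary\<close> the conclusion for the other diagonal is obtained by
  exchanging \<open>c\<close> and \<open>d\<close>; interchanging cells in the second position follows from
  \<open>sym\<close> and \<open>saturation\<close>.
\<close>

inductive cert :: "nat \<Rightarrow> nat \<Rightarrow> aug_config \<Rightarrow> cell \<Rightarrow> cell \<Rightarrow> int \<Rightarrow> bool"
  for m n :: nat and C :: aug_config where
  sym: "cert m n C p q a \<Longrightarrow> cert m n C q p a"
| unit: "\<lbrakk>p \<in> grid m n; p \<in> occupied C\<rbrakk> \<Longrightarrow> cert m n C p p 1"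
| hole: "\<lbrakk>p \<in> grid m n; q \<in> grid m n; p \<notin> occupied C \<or> q \<notin> occupied C\<rbrakk>
         \<Longrightarrow> cert m n C p q 0"
| line: "\<lbrakk>p \<in> grid m n; q \<in> grid m n; p \<noteq> q; fst p = fst q \<or> snd p = snd q\<rbrakk>
         \<Longrightarrow> cert m n C p q (delta C p q)"
| rectangle: "\<lbrakk>r \<in> {1..m}; s \<in> {1..m}; r \<noteq> s; c \<in> {1..n}; d \<in> {1..n}; c \<noteq> d;
               cert m n C (r, c) (s, d) a\<rbrakk>
         \<Longrightarrow> cert m n C (r, d) (s, c)
               (delta C (r, c) (s, d) + delta C (r, d) (s, c) - a)"
| complementary: "\<lbrakk>r \<in> {1..m}; s \<in> {1..m}; r \<noteq> s; c \<in> {1..n}; d \<in> {1..n}; c \<noteq> d;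
               {(r, c), (s, d)} \<in> two_edges C; {(r, d), (s, c)} \<in> two_edges C\<rbrakk>
         \<Longrightarrow> cert m n C (r, c) (s, d) 1"
| saturation: "\<lbrakk>cert m n C p p' 1; cert m n C p q a\<rbrakk> \<Longrightarrow> cert m n C p' q a"

definition cert_equiv :: "nat \<Rightarrow> nat \<Rightarrow> aug_config \<Rightarrow> (cell \<times> cell) set" where
  "cert_equiv m n C = {(p, q). cert m n C p q 1}"

definition cert_orth :: "nat \<Rightarrow> nat \<Rightarrow> aug_config \<Rightarrow> cell \<Rightarrow> cell \<Rightarrow> bool" where
  "cert_orth m n C p q \<longleftrightarrow> cert m n C p q 0"

text \<open>In the second clause, \<open>cert_equiv m n C `` {p}\<close> is the equivalence class of \<open>p\<close>.\<close>

definition RW3_plus :: "nat \<Rightarrow> nat \<Rightarrow> aug_config \<Rightarrow> bool" where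
  "RW3_plus m n C \<longleftrightarrow>
     (\<forall>p q. {p, q} \<in> two_edges C \<longrightarrow> (p, q) \<in> cert_equiv m n C) \<and>
     (\<forall>e\<in>two_edges C. \<forall>f\<in>two_edges C. e \<noteq> f \<longrightarrow>
        (\<forall>p\<in>e. \<forall>q\<in>f. cert_equiv m n C `` {p} \<noteq> cert_equiv m n C `` {q})) \<and>
     (\<forall>e\<in>edge_elements C. \<forall>f\<in>edge_elements C. e \<noteq> f \<longrightarrow>
        (\<exists>p\<in>e. \<exists>q\<in>f. cert_orth m n C p q))"

definition z_RL :: "nat \<Rightarrow> nat \<Rightarrow> nat" where
  "z_RL m n = Max {card (one_edges C) + card (two_edges C) | C.
     simple_config m n C \<and> limited m n C \<and> RW3_plus m n C}"

section \<open>The configurations \<open>K\<^sub>t\<close>\<close>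

text \<open>Entry \<open>0\<close> marks a one-edge; an entry \<open>j \<ge> 1\<close> marks a half of the two-edge \<open>b\<^sub>j\<close>.\<close>

definition K0_table :: "nat list list" where
  "K0_table =
    [[ 0,  0,  4,  3,  4],
     [ 0,  5,  0, 13,  6],
     [ 0, 13, 19,  0,  1],
     [ 0,  7, 18,  7,  0],
     [ 2,  0,  0,  2,  1],
     [18,  0, 17,  0, 19],
     [15,  0, 16, 17,  0],
     [12,  6,  0,  0,  5],
     [14, 15,  0,  3,  0],
     [11,  8,  9,  0,  0],
     [10,  9,  8,  0, 12],
     [10, 14, 11, 16,  0]]"

definition K0_entry :: "cell \<Rightarrow> nat" where
  "K0_entry p = K0_table ! (fst p - 1) ! (snd p - 1)"

definition K0_b :: "nat \<Rightarrow> cell set" where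
  "K0_b j = {p \<in> grid 12 5. K0_entry p = j}"

definition K0 :: aug_config where
  "K0 = \<lparr>one_edges = {p \<in> grid 12 5. K0_entry p = 0}, two_edges = K0_b ` {1..19}\<rparr>"

text \<open>
  In the two-edges \<open>P\<^sub>j\<close>, \<open>Q\<^sub>j\<close> (\<open>0 \<le> j \<le> t\<close>), row \<open>12 + j\<close> is \<open>r\<^bsub>j+1\<^esub>\<close> if \<open>j < t\<close> and \<open>w\<close> if
  \<open>j = t\<close>; row \<open>11 + j\<close> is \<open>r\<^sub>j\<close>.
\<close>

definition K_P :: "nat \<Rightarrow> cell set" where
  "K_P j = {if j = 0 then (9, 1) else (11 + j, 1), (12 + j, 2)}"

definition K_Q :: "nat \<Rightarrow> cell set" where
  "K_Q j = {if j = 0 then (7, 3) else (11 + j, 3), (12 + j, 4)}"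

definition K :: "nat \<Rightarrow> aug_config" where
  "K t = (if t = 0 then K0 else
     \<lparr>one_edges = {p \<in> grid 11 5. K0_entry p = 0} \<union> {(11 + i, 5) | i. i \<in> {1..t}} \<union> {(12 + t, 5)},
      two_edges = K0_b ` ({1..19} - {10, 11, 14, 16})
        \<union> {{(11, 1), (12 + t, 1)}, {(10, 1), (12 + t, 3)}}
        \<union> K_P ` {0..t} \<union> K_Q ` {0..t}\<rparr>)"

end

theory Submission
  imports Defs
begin

text \<open>
  \<^bold>\<open>Upper bound.\<close> Every cell of the grid is a one-edge, a half of exactly one two-edge, or a hole, so
  \<open>|E\<^sub>1| + 2|E\<^sub>2| + H = 5m\<close> (\<open>count_cells\<close>). In a \<open>C\<^sub>4\<close>-free graph, sending each edge that is not the
  first of its row to the pair formed by its column and the first column of its row is injective, so there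
  are at most \<open>m + 10\<close> edges; the one-edges of \<open>K\<^sub>t\<close> attain this, whence \<open>z(m,5) = m + 10\<close>. A limited
  configuration therefore has \<open>|E\<^sub>2| \<le> (5m - (m + 10)) / 2 = 2m - 5\<close>.

  \<^bold>\<open>What has to be certified.\<close> Give two cells the value 1 if they carry the same edge element and 0
  otherwise. All rules preserve this assignment, so every certified value is the value in this model
  (\<open>cert_sound\<close>). In particular distinct two-edges are never identified, and \<open>(RW3\<^sup>+)\<close> follows as
  soon as \<^emph>\<open>every\<close> pair of cells has some certified value (\<open>RW3_plus_if_decided\<close>). The values need not be
  tracked any more: a derivation is a search for the set of ``known'' pairs, closed under exchanging the
  two diagonals of a rectangle and under exchanging the halves of a two-edge whose halves form a known pair.

  \<^bold>\<open>The witness.\<close> Writing \<open>P\<^bsub>t+1\<^esub>\<close> and \<open>Q\<^bsub>t+1\<^esub>\<close> for \<open>b\<^bsub>10\<^esub>\<close> and \<open>b\<^bsub>11\<^esub>\<close>, every row \<open>11 + a\<close> with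
  \<open>1 \<le> a \<le> t + 1\<close> reads \<open>P\<^sub>a, P\<^bsub>a-1\<^esub>, Q\<^sub>a, Q\<^bsub>a-1\<^esub>\<close> and a one-edge, so the last row needs no separate
  treatment. For \<open>t \<ge> 1\<close> the halves of \<open>P\<^sub>t, P\<^bsub>t-1\<^esub>, ..., P\<^sub>0\<close> are identified in this order, since the other
  diagonal of the rectangle spanned by \<open>P\<^sub>a\<close> contains a half of \<open>P\<^bsub>a+1\<^esub>\<close>; then the same is done for \<open>Q\<close>. Two
  elements of the chains are orthogonal by induction on the distance of their indices: a rectangle turns the pair \<open>P\<^sub>a, Q\<^sub>b\<close>
  with \<open>a < b\<close> into \<open>P\<^bsub>b-1\<^esub>, Q\<^bsub>a+1\<^esub>\<close>, until the two share a row.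

  All other pairs involve at least one of the eleven fixed rows, and here all chain rows can be treated
  simultaneously: a pair of a cell in a fixed row and a column of the chain block counts as known if it is
  known for every chain row. The columns 1 and 2 of the block carry the label sets
  \<open>{P\<^sub>1, ..., P\<^bsub>t+1\<^esub>}\<close> and \<open>{P\<^sub>0, ..., P\<^sub>t}\<close>, so a cell that knows one of these columns and the missing
  end of the chain knows the other column. This turns the problem for arbitrary \<open>t \<ge> 1\<close> into a closure
  computation on a grid with twelve rows, which does not depend on \<open>t\<close>. That computation, and the one for the
  seed \<open>K\<^sub>0\<close> itself, is carried out by rewriting (\<open>closure_chain\<close>, \<open>closure_K0\<close>).
\<close>

section \<open>Certified values agree with the edge-element model\<close>

text \<open>
  The Gram matrix that all certificates describe: the edge elements are orthonormal vectors, and the cells of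
  one edge element carry the same vector.
\<close>

definition model :: "aug_config \<Rightarrow> cell \<Rightarrow> cell \<Rightarrow> int" where
  "model C p q = (if p = q then (if p \<in> occupied C then 1 else 0) else delta C p q)"

lemma finite_grid [simp]: "finite (grid m n)"
  by (simp add: grid_def)

lemma augmentedD:
  assumes "augmented m n C" "e \<in> two_edges C"
  shows "e \<subseteq> grid m n" "card e = 2" "one_edges C \<inter> e = {}" "e \<subseteq> occupied C"
    and "\<And>f. f \<in> two_edges C \<Longrightarrow> f \<noteq> e \<Longrightarrow> f \<inter> e = {}"
proof -
  show "e \<subseteq> grid m n" "card e = 2" "one_edges C \<inter> e = {}"
    using assms by (simp_all add: augmented_def)
  show "e \<subseteq> occupied C" using assms(2) by (auto simp: occupied_def)
  show "f \<inter> e = {}" if "f \<in> two_edges C" "f \<noteq> e" for f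
    using assms that unfolding augmented_def by blast
qed

lemma two_edge_neq: "augmented m n C \<Longrightarrow> {p, q} \<in> two_edges C \<Longrightarrow> p \<noteq> q"
  using augmentedD(2)[of m n C "{p, q}"] by (cases "p = q") auto

lemma two_edge_unique:
  assumes "augmented m n C" "{p, q} \<in> two_edges C" "{p, q'} \<in> two_edges C"
  shows "q = q'"
proof -
  have "{p, q} = {p, q'}"
    using augmentedD(5)[OF assms(1,2,3)] by auto
  then show ?thesis by (auto simp: doubleton_eq_iff)
qed

lemma model_sym: "model C p q = model C q p"
  by (simp add: model_def delta_def insert_commute)

lemma model_eq_1_iff:
  assumes "augmented m n C" "p \<in> occupied C"
  shows "model C p q = 1 \<longleftrightarrow> p = q \<or> {p, q} \<in> two_edges C"
  using two_edge_neq[OF assms(1), of p q] assms(2) by (auto simp: model_def delta_def)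

lemma model_unoccupied:
  assumes "augmented m n C" "p \<notin> occupied C"
  shows "model C p q = 0"
proof -
  have "{p, q} \<notin> two_edges C" using augmentedD(4)[OF assms(1), of "{p, q}"] assms(2) by blast
  then show ?thesis using assms(2) by (auto simp: model_def delta_def)
qed

lemma model_01: "model C p q \<in> {0, 1}"
  by (simp add: model_def delta_def)

lemma model_halves:
  assumes "augmented m n C" "{p, p'} \<in> two_edges C"
  shows "model C p' q = model C p q"
proof -
  have occ: "p \<in> occupied C" "p' \<in> occupied C"
    using augmentedD(4)[OF assms] by auto
  have "model C p' q = 1 \<longleftrightarrow> model C p q = 1"
    using assms two_edge_unique[OF assms(1)] insert_commute[of p p' "{}"]
    unfolding model_eq_1_iff[OF assms(1) occ(1)] model_eq_1_iff[OF assms(1) occ(2)] by metis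
  then show ?thesis
    using model_01[of C p q] model_01[of C p' q] by auto
qed

text \<open>
  The orthonormal model satisfies all rules. For saturation, a certified value 1 means that the two cells
  are equal or the two halves of one two-edge, and then they carry the same vector.
\<close>

lemma cert_sound:
  assumes aug: "augmented m n C" and "cert m n C p q a"
  shows "p \<in> grid m n" "q \<in> grid m n" "a = model C p q"
proof -
  have "p \<in> grid m n \<and> q \<in> grid m n \<and> a = model C p q"
    using assms(2)
  proof induction
    case (sym p q a)
    then show ?case by (simp add: model_sym)
  next
    case (unit p)
    then show ?case by (simp add: model_def)
  next
    case (hole p q)
    then show ?case
      using model_unoccupied[OF aug] model_sym by metis
  next
    case (line p q)
    then show ?case by (simp add: model_def)
  next
    case (rectangle r s c d a)
    then show ?case by (simp add: model_def grid_def)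
  next
    case (complementary r s c d)
    then show ?case by (simp add: model_def grid_def delta_def)
  next
    case (saturation p p' q a)
    then show ?case
      using model_halves[OF aug] model_eq_1_iff[OF aug] model_unoccupied[OF aug]
      by (metis zero_neq_one)
  qed
  then show "p \<in> grid m n" "q \<in> grid m n" "a = model C p q" by auto
qed

text \<open>
  By \<open>cert_sound\<close> this says that \<^emph>\<open>some\<close> value is certified for the pair; naming the value makes the rules
  below independent of it.
\<close>

definition decided :: "nat \<Rightarrow> nat \<Rightarrow> aug_config \<Rightarrow> cell \<Rightarrow> cell \<Rightarrow> bool" where
  "decided m n C p q \<longleftrightarrow> cert m n C p q (model C p q)"

lemma decided_sym: "decided m n C p q \<Longrightarrow> decided m n C q p"
  unfolding decided_def using cert.sym model_sym by metis

lemma decided_line: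
  assumes "p \<in> grid m n" "q \<in> grid m n" "fst p = fst q \<or> snd p = snd q"
  shows "decided m n C p q"
proof (cases "p = q")
  case True
  then show ?thesis
    using assms(1) cert.unit[of p m n C] cert.hole[of p m n p C]
    by (cases "p \<in> occupied C") (simp_all add: decided_def model_def)
next
  case False
  then show ?thesis
    using cert.line[OF assms(1,2) False assms(3)] by (simp add: decided_def model_def)
qed

text \<open>
  Both diagonals of a rectangle have the model value given by \<open>delta\<close>, so the rectangle rule never changes
  more than the position. Degenerate rectangles are covered by the line rule, which spares all later
  applications the case distinction.
\<close>

lemma decided_rectangle:
  assumes "augmented m n C" "decided m n C (r, c) (s, d)"
  shows "decided m n C (r, d) (s, c)"
proof -
  have g: "(r, c) \<in> grid m n" "(s, d) \<in> grid m n"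
    using cert_sound(1,2)[OF assms(1) assms(2)[unfolded decided_def]] .
  show ?thesis
  proof (cases "r = s \<or> c = d")
    case True
    with g show ?thesis by (intro decided_line) (auto simp: grid_def)
  next
    case False
    then show ?thesis
      using cert.rectangle[of r m s c n d C "model C (r, c) (s, d)"] g assms(2)
      by (simp add: decided_def model_def grid_def)
  qed
qed

lemma decided_complementary:
  assumes "augmented m n C" "{(r, c), (s, d)} \<in> two_edges C" "{(r, d), (s, c)} \<in> two_edges C"
  shows "decided m n C (r, c) (s, d)"
proof -
  have g: "(r, c) \<in> grid m n" "(s, d) \<in> grid m n" "(r, c) \<noteq> (s, d)" "(r, d) \<noteq> (s, c)"
    using augmentedD(1)[OF assms(1,2)] two_edge_neq[OF assms(1,2)] two_edge_neq[OF assms(1,3)]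
    by simp_all
  show ?thesis
  proof (cases "r = s \<or> c = d")
    case True
    with g show ?thesis by (intro decided_line) simp_all
  next
    case False
    then show ?thesis
      using cert.complementary[of r m s c n d C] g assms
      by (simp add: decided_def model_def delta_def grid_def)
  qed
qed

lemma decided_halves:
  assumes "augmented m n C" "{p, p'} \<in> two_edges C" "decided m n C p p'" "decided m n C p q"
  shows "decided m n C p' q"
proof -
  have "cert m n C p p' 1"
    using assms(2,3) two_edge_neq[OF assms(1,2)] by (simp add: decided_def model_def delta_def)
  then show ?thesis
    using cert.saturation[OF _ assms(4)[unfolded decided_def]]
    unfolding decided_def model_halves[OF assms(1,2)] by blast
qed

text \<open>
  The second clause holds in every augmented configuration, by soundness: the cells equivalent to a half of a
  two-edge lie in that two-edge. The other two clauses only ask for the model values 1 and 0.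
\<close>

theorem RW3_plus_if_decided:
  assumes aug: "augmented m n C" and dec: "\<And>p q. p \<in> grid m n \<Longrightarrow> q \<in> grid m n \<Longrightarrow> decided m n C p q"
  shows "RW3_plus m n C"
  unfolding RW3_plus_def
proof (intro conjI allI impI ballI)
  fix p q assume e: "{p, q} \<in> two_edges C"
  then have "decided m n C p q" using augmentedD(1)[OF aug e] dec[of p q] by simp
  then show "(p, q) \<in> cert_equiv m n C"
    using e two_edge_neq[OF aug e] by (simp add: cert_equiv_def decided_def model_def delta_def)
next
  fix e f p q
  assume ef: "e \<in> two_edges C" "f \<in> two_edges C" "e \<noteq> f" and pq: "p \<in> e" "q \<in> f"
  have q: "q \<in> grid m n" "q \<in> occupied C" using augmentedD(1,4)[OF aug ef(2)] pq(2) by auto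
  show "cert_equiv m n C `` {p} \<noteq> cert_equiv m n C `` {q}"
  proof
    assume "cert_equiv m n C `` {p} = cert_equiv m n C `` {q}"
    moreover have "q \<in> cert_equiv m n C `` {q}"
      using cert.unit[OF q] by (simp add: cert_equiv_def)
    ultimately have "q \<in> cert_equiv m n C `` {p}" by simp
    then have "cert m n C p q 1" by (simp add: cert_equiv_def)
    then have "p = q \<or> {p, q} \<in> two_edges C"
      using cert_sound(3)[OF aug] model_eq_1_iff[OF aug] model_unoccupied[OF aug]
      by (metis zero_neq_one)
    then show False
    proof
      assume "p = q"
      then show False using augmentedD(5)[OF aug ef(2) ef(1) ef(3)] pq by auto
    next
      assume g: "{p, q} \<in> two_edges C"
      have "{p, q} = e" "{p, q} = f"
        using augmentedD(5)[OF aug ef(1) g] augmentedD(5)[OF aug ef(2) g] pq by blast+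
      then show False using ef(3) by simp
    qed
  qed
next
  fix e f assume ef: "e \<in> edge_elements C" "f \<in> edge_elements C" "e \<noteq> f"
  have el: "x \<in> two_edges C \<or> (\<exists>p\<in>one_edges C. x = {p})" if "x \<in> edge_elements C" for x
    using that by (auto simp: edge_elements_def)
  have sub: "x \<subseteq> grid m n \<and> x \<noteq> {}" if "x \<in> edge_elements C" for x
  proof (cases "x \<in> two_edges C")
    case True
    then show ?thesis using augmentedD(1,2)[OF aug True] by auto
  next
    case False
    then show ?thesis using el[OF that] aug by (auto simp: augmented_def)
  qed
  have meet: "x = y" if "x \<in> edge_elements C" "y \<in> edge_elements C" "x \<inter> y \<noteq> {}" for x y
    using el[OF that(1)] el[OF that(2)] that(3) augmentedD(3,5)[OF aug] by (metis disjoint_iff singletonD)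
  have disj: "e \<inter> f = {}" using meet ef by blast
  obtain p q where pq: "p \<in> e" "q \<in> f" using sub ef by blast
  have "{p, q} \<notin> two_edges C"
  proof
    assume "{p, q} \<in> two_edges C"
    then have "{p, q} \<in> edge_elements C" by (simp add: edge_elements_def)
    then have "e = {p, q}" "f = {p, q}" using meet ef pq by blast+
    then show False using ef(3) by simp
  qed
  moreover have "p \<noteq> q" using pq disj by blast
  ultimately have "model C p q = 0" by (simp add: model_def delta_def)
  then have "cert_orth m n C p q"
    using dec[of p q] pq sub[OF ef(1)] sub[OF ef(2)] by (auto simp: cert_orth_def decided_def)
  then show "\<exists>p\<in>e. \<exists>q\<in>f. cert_orth m n C p q" using pq by blast
qed

section \<open>Counting cells and one-edges\<close>

lemma count_cells:
  assumes "augmented m n C"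
  shows "card (one_edges C) + 2 * card (two_edges C) + card (holes m n C) = m * n"
proof -
  have "two_edges C \<subseteq> Pow (grid m n)" using augmentedD(1)[OF assms] by blast
  then have fin: "finite (two_edges C)" by (rule finite_subset) simp
  have one: "one_edges C \<subseteq> grid m n" using assms by (simp add: augmented_def)
  then have fin1: "finite (one_edges C)" by (rule finite_subset) simp
  have two: "\<Union>(two_edges C) \<subseteq> grid m n" using augmentedD(1)[OF assms] by auto
  have "card (\<Union>(two_edges C)) = (\<Sum>e\<in>two_edges C. card e)"
  proof (rule card_Union_disjoint)
    show "pairwise disjnt (two_edges C)"
      unfolding pairwise_def disjnt_def using augmentedD(5)[OF assms] by blast
    show "finite e" if "e \<in> two_edges C" for e
      using augmentedD(1)[OF assms that] by (rule finite_subset) simp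
  qed
  also have "\<dots> = 2 * card (two_edges C)"
    using augmentedD(2)[OF assms] by simp
  finally have halves: "card (\<Union>(two_edges C)) = 2 * card (two_edges C)" .
  have "card (occupied C) = card (one_edges C) + 2 * card (two_edges C)"
  proof -
    have "one_edges C \<inter> \<Union>(two_edges C) = {}" using augmentedD(3)[OF assms] by blast
    then show ?thesis
      unfolding occupied_def using fin1 finite_subset[OF two finite_grid] halves
      by (simp add: card_Un_disjoint)
  qed
  moreover have "card (holes m n C) + card (occupied C) = card (grid m n)"
  proof -
    have sub: "occupied C \<subseteq> grid m n" using one two by (auto simp: occupied_def)
    then show ?thesis
      unfolding holes_def using card_mono[OF finite_grid sub]
      by (simp add: card_Diff_subset finite_subset[OF sub])
  qed
  ultimately show ?thesis by (simp add: grid_def)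
qed

text \<open>
  If two edges in different rows, neither of them the first in its row, had the same pair of own column and
  first column, their rows would share both columns. Hence the edges that are not first inject into the
  2-subsets of the columns.
\<close>

lemma C4_free_card_le:
  assumes E: "E \<subseteq> grid m n" "C4_free E"
  shows "card E \<le> m + (n choose 2)"
proof -
  have fin: "finite E" using E(1) by (rule finite_subset) simp
  define first where "first r = Min {c. (r, c) \<in> E}" for r
  define F where "F = {p \<in> E. snd p = first (fst p)}"
  have first: "(fst p, first (fst p)) \<in> E" if "p \<in> E" for p
  proof -
    have "{c. (fst p, c) \<in> E} \<subseteq> {1..n}" using E(1) by (auto simp: grid_def)
    then have "finite {c. (fst p, c) \<in> E}" by (rule finite_subset) simp
    then show ?thesis using that Min_in[of "{c. (fst p, c) \<in> E}"] by (cases p) (auto simp: first_def)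
  qed
  have "inj_on fst F" by (auto simp: F_def inj_on_def)
  moreover have "fst ` F \<subseteq> {1..m}" using E(1) by (auto simp: F_def grid_def)
  ultimately have le1: "card F \<le> m" using card_inj_on_le[of fst F "{1..m}"] by simp
  have "inj_on (\<lambda>p. {first (fst p), snd p}) (E - F)"
  proof (rule inj_onI)
    fix p q assume p: "p \<in> E - F" and q: "q \<in> E - F"
      and eq: "{first (fst p), snd p} = {first (fst q), snd q}"
    have ne: "first (fst p) \<noteq> snd p" using p by (auto simp: F_def)
    have "fst p = fst q"
    proof (rule ccontr)
      assume r: "fst p \<noteq> fst q"
      have "(fst p, first (fst p)) \<in> E" "(fst p, snd p) \<in> E"
        "(fst q, first (fst p)) \<in> E" "(fst q, snd p) \<in> E"
        using first[of p] first[of q] p q eq by (auto simp: doubleton_eq_iff)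
      with r ne E(2) show False unfolding C4_free_def by blast
    qed
    with eq ne show "p = q" by (auto simp: doubleton_eq_iff prod_eq_iff)
  qed
  moreover have "(\<lambda>p. {first (fst p), snd p}) ` (E - F) \<subseteq> {B. B \<subseteq> {1..n} \<and> card B = 2}"
    using first E(1) by (fastforce simp: F_def grid_def)
  ultimately have "card (E - F) \<le> card {B. B \<subseteq> {1..n} \<and> card B = 2}"
    by (rule card_inj_on_le) simp
  then have "card (E - F) \<le> n choose 2" by (simp add: n_subsets)
  moreover have "card E = card F + card (E - F)"
    using fin by (subst card_Diff_subset) (auto simp: F_def card_mono)
  ultimately show ?thesis using le1 by simp
qed

section \<open>The configurations as labelled grids\<close>

datatype label = One nat nat | B nat | P nat | Q nat

text \<open>
  The label of a cell names its edge element. The two-edges \<open>b\<^bsub>10\<^esub>\<close>, \<open>b\<^bsub>11\<^esub>\<close> become \<open>P (t + 1)\<close>, \<open>Q (t + 1)\<close>,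
  and \<open>b\<^bsub>14\<^esub>\<close>, \<open>b\<^bsub>16\<^esub>\<close> of the seed become \<open>P 0\<close>, \<open>Q 0\<close>; with this choice the same description holds for
  \<open>t = 0\<close> and for the last row.
\<close>

definition lab :: "nat \<Rightarrow> cell \<Rightarrow> label" where
  "lab t p = (case p of (r, c) \<Rightarrow>
     if r \<le> 11 then
       (let j = K0_entry (r, c) in
        if j = 0 then One r c
        else if j = 10 then P (t + 1) else if j = 11 then Q (t + 1)
        else if j = 14 then P 0 else if j = 16 then Q 0
        else B j)
     else if c = 1 then P (r - 11) else if c = 2 then P (r - 12)
     else if c = 3 then Q (r - 11) else if c = 4 then Q (r - 12)
     else One r c)"

definition fibre :: "nat \<Rightarrow> label \<Rightarrow> cell set" where
  "fibre t l = {p \<in> grid (12 + t) 5. lab t p = l}"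

definition K_labels :: "nat \<Rightarrow> label set" where
  "K_labels t = B ` ({1..19} - {10, 11, 14, 16}) \<union> P ` {0..t + 1} \<union> Q ` {0..t + 1}"

lemma grid_as_list: "grid m n = set (List.product [1..<Suc m] [1..<Suc n])"
  by (auto simp: grid_def)

lemma K0_b_as_list: "K0_b j = set (filter (\<lambda>p. K0_entry p = j) (List.product [1..<13] [1..<6]))"
  unfolding K0_b_def using grid_as_list[of 12 5] by auto

lemma K0_b_chain_ends:
  "K0_b 10 = {(11, 1), (12, 1)}" "K0_b 11 = {(10, 1), (12, 3)}"
  "K0_b 14 = {(9, 1), (12, 2)}" "K0_b 16 = {(7, 3), (12, 4)}"
proof -
  have "filter (\<lambda>p. K0_entry p = 10) (List.product [1..<13] [1..<6]) = [(11, 1), (12, 1)]"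
    "filter (\<lambda>p. K0_entry p = 11) (List.product [1..<13] [1..<6]) = [(10, 1), (12, 3)]"
    "filter (\<lambda>p. K0_entry p = 14) (List.product [1..<13] [1..<6]) = [(9, 1), (12, 2)]"
    "filter (\<lambda>p. K0_entry p = 16) (List.product [1..<13] [1..<6]) = [(7, 3), (12, 4)]"
    by code_simp+
  then show "K0_b 10 = {(11, 1), (12, 1)}" "K0_b 11 = {(10, 1), (12, 3)}"
    "K0_b 14 = {(9, 1), (12, 2)}" "K0_b 16 = {(7, 3), (12, 4)}"
    by (simp_all add: K0_b_as_list)
qed

text \<open>
  Reduces statements about the seed table to evaluation over its sixty cells.
\<close>

lemma grid_12_5_check:
  "list_all A (List.product [1..<13] [1..<6]) \<Longrightarrow> p \<in> grid 12 5 \<Longrightarrow> A p"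
  using grid_as_list[of 12 5] unfolding list_all_iff by (metis Suc_numeral semiring_norm(2,5,8))

lemma K0_entry_low:
  assumes "(r, c) \<in> grid 11 5"
  shows "K0_entry (r, c) = 10 \<longleftrightarrow> r = 11 \<and> c = 1" "K0_entry (r, c) = 11 \<longleftrightarrow> r = 10 \<and> c = 1"
    "K0_entry (r, c) = 14 \<longleftrightarrow> r = 9 \<and> c = 1" "K0_entry (r, c) = 16 \<longleftrightarrow> r = 7 \<and> c = 3"
    "K0_entry (r, c) \<le> 19"
proof -
  let ?Q = "\<lambda>p. fst p < 12 \<longrightarrow> K0_entry p \<le> 19 \<and> (K0_entry p = 10 \<longleftrightarrow> p = (11, 1)) \<and> (K0_entry p = 11 \<longleftrightarrow> p = (10, 1))
    \<and> (K0_entry p = 14 \<longleftrightarrow> p = (9, 1)) \<and> (K0_entry p = 16 \<longleftrightarrow> p = (7, 3))"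
  have r: "(r, c) \<in> grid 12 5" "r < 12" using assms by (auto simp: grid_def)
  have "list_all ?Q (List.product [1..<13] [1..<6])" by code_simp
  from grid_12_5_check[of ?Q, OF this r(1)] have "?Q (r, c)" .
  with r(2) show "K0_entry (r, c) = 10 \<longleftrightarrow> r = 11 \<and> c = 1" "K0_entry (r, c) = 11 \<longleftrightarrow> r = 10 \<and> c = 1"
    "K0_entry (r, c) = 14 \<longleftrightarrow> r = 9 \<and> c = 1" "K0_entry (r, c) = 16 \<longleftrightarrow> r = 7 \<and> c = 3"
    "K0_entry (r, c) \<le> 19" by auto
qed

lemma K0_row_12: "K0_entry (12, 1) = 10" "K0_entry (12, 2) = 14" "K0_entry (12, 3) = 11" "K0_entry (12, 4) = 16"
  "K0_entry (12, 5) = 0"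
  by code_simp+

lemma lab_low:
  assumes "(r, c) \<in> grid 11 5"
  shows "lab t (r, c) =
    (if K0_entry (r, c) = 0 then One r c
     else if (r, c) = (11, 1) then P (t + 1) else if (r, c) = (10, 1) then Q (t + 1)
     else if (r, c) = (9, 1) then P 0 else if (r, c) = (7, 3) then Q 0
     else B (K0_entry (r, c)))"
  using K0_entry_low[OF assms] assms by (auto simp: lab_def Let_def grid_def)

lemma lab_high:
  "12 \<le> r \<Longrightarrow> lab t (r, c) =
     (if c = 1 then P (r - 11) else if c = 2 then P (r - 12)
      else if c = 3 then Q (r - 11) else if c = 4 then Q (r - 12) else One r c)"
  by (simp add: lab_def)

lemma grid_K: "(r, c) \<in> grid (12 + t) 5 \<longleftrightarrow> (r, c) \<in> grid 11 5 \<or> 12 \<le> r \<and> r \<le> 12 + t \<and> 1 \<le> c \<and> c \<le> 5"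
  by (auto simp: grid_def)

lemma K0_entry_ends: "K0_entry (11, 1) = 10" "K0_entry (10, 1) = 11" "K0_entry (9, 1) = 14" "K0_entry (7, 3) = 16"
  by code_simp+

lemma fibre_P:
  assumes "a \<le> t + 1"
  shows "fibre t (P a) = (if a = t + 1 then {(11, 1), (12 + t, 1)} else K_P a)"
proof -
  (* A row 12 + k carries P (k + 1) and P k; the first eleven rows contribute only the ends of the chain. *)
  have "(r, c) \<in> grid (12 + t) 5 \<and> lab t (r, c) = P a \<longleftrightarrow>
    (r, c) \<in> (if a = t + 1 then {(11, 1), (12 + t, 1)} else K_P a)" for r c
  proof (cases "(r, c) \<in> grid 11 5")
    case True
    then have "r \<le> 11" "lab t (r, c) = P a \<longleftrightarrow> r = 11 \<and> c = 1 \<and> a = t + 1 \<or> r = 9 \<and> c = 1 \<and> a = 0"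
      using lab_low[OF True, of t] K0_entry_ends by (auto simp: grid_def)
    then show ?thesis
      using True unfolding grid_K by (auto simp: K_P_def)
  next
    case False
    then have "r \<noteq> 11 \<or> c \<noteq> 1" "r \<noteq> 9 \<or> c \<noteq> 1" by (auto simp: grid_def)
    note out = this
    show ?thesis
    proof (cases "12 \<le> r")
      case True
      then obtain k where r: "r = 12 + k" using le_Suc_ex by blast
      have "lab t (r, c) = P a \<longleftrightarrow> c = 1 \<and> a = k + 1 \<or> c = 2 \<and> a = k"
        using lab_high[of r t c] r by auto
      then have "(r, c) \<in> grid (12 + t) 5 \<and> lab t (r, c) = P a \<longleftrightarrow>
          k \<le> t \<and> (c = 1 \<and> a = k + 1 \<or> c = 2 \<and> a = k)"
        using False r unfolding grid_K by auto
      moreover have "(r, c) \<in> (if a = t + 1 then {(y, 1), (12 + t, 1)} else K_P a) \<longleftrightarrow>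
          k \<le> t \<and> (c = 1 \<and> a = k + 1 \<or> c = 2 \<and> a = k)" if "y < 12" for y
        using assms r that by (cases "a = t + 1"; cases "a = 0") (auto simp: K_P_def)
      ultimately show ?thesis by simp
    next
      case low: False
      then have "(r, c) \<notin> grid (12 + t) 5" using False by (simp add: grid_K)
      moreover have "(r, c) \<notin> (if a = t + 1 then {(11, 1), (12 + t, 1)} else K_P a)"
        using out low by (cases "a = t + 1"; cases "a = 0") (auto simp: K_P_def)
      ultimately show ?thesis by simp
    qed
  qed
  then show ?thesis unfolding fibre_def set_eq_iff split_paired_All mem_Collect_eq by blast
qed

lemma fibre_Q:
  assumes "a \<le> t + 1"
  shows "fibre t (Q a) = (if a = t + 1 then {(10, 1), (12 + t, 3)} else K_Q a)"
proof -
  have "(r, c) \<in> grid (12 + t) 5 \<and> lab t (r, c) = Q a \<longleftrightarrow>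
    (r, c) \<in> (if a = t + 1 then {(10, 1), (12 + t, 3)} else K_Q a)" for r c
  proof (cases "(r, c) \<in> grid 11 5")
    case True
    then have "r \<le> 11" "lab t (r, c) = Q a \<longleftrightarrow> r = 10 \<and> c = 1 \<and> a = t + 1 \<or> r = 7 \<and> c = 3 \<and> a = 0"
      using lab_low[OF True, of t] K0_entry_ends by (auto simp: grid_def)
    then show ?thesis
      using True unfolding grid_K by (auto simp: K_Q_def)
  next
    case False
    then have "r \<noteq> 10 \<or> c \<noteq> 1" "r \<noteq> 7 \<or> c \<noteq> 3" by (auto simp: grid_def)
    note out = this
    show ?thesis
    proof (cases "12 \<le> r")
      case True
      then obtain k where r: "r = 12 + k" using le_Suc_ex by blast
      have "lab t (r, c) = Q a \<longleftrightarrow> c = 3 \<and> a = k + 1 \<or> c = 4 \<and> a = k"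
        using lab_high[of r t c] r by auto
      then have "(r, c) \<in> grid (12 + t) 5 \<and> lab t (r, c) = Q a \<longleftrightarrow>
          k \<le> t \<and> (c = 3 \<and> a = k + 1 \<or> c = 4 \<and> a = k)"
        using False r unfolding grid_K by auto
      moreover have "(r, c) \<in> (if a = t + 1 then {(y, 1), (12 + t, 3)} else K_Q a) \<longleftrightarrow>
          k \<le> t \<and> (c = 3 \<and> a = k + 1 \<or> c = 4 \<and> a = k)" if "y < 12" for y
        using assms r that by (cases "a = t + 1"; cases "a = 0") (auto simp: K_Q_def)
      ultimately show ?thesis by simp
    next
      case low: False
      then have "(r, c) \<notin> grid (12 + t) 5" using False by (simp add: grid_K)
      moreover have "(r, c) \<notin> (if a = t + 1 then {(10, 1), (12 + t, 3)} else K_Q a)"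
        using out low by (cases "a = t + 1"; cases "a = 0") (auto simp: K_Q_def)
      ultimately show ?thesis by simp
    qed
  qed
  then show ?thesis unfolding fibre_def set_eq_iff split_paired_All mem_Collect_eq by blast
qed

lemma fibre_B:
  assumes "j \<in> {1..19} - {10, 11, 14, 16}"
  shows "fibre t (B j) = K0_b j"
proof -
  have row_12: "K0_entry (12, c) \<noteq> j" if "1 \<le> c" "c \<le> 5" for c
  proof -
    have "c \<in> {1, 2, 3, 4, 5}" using that by auto
    then show ?thesis using assms K0_row_12 by auto
  qed
  have "(r, c) \<in> grid (12 + t) 5 \<and> lab t (r, c) = B j \<longleftrightarrow> (r, c) \<in> grid 12 5 \<and> K0_entry (r, c) = j" for r c
  proof (cases "(r, c) \<in> grid 11 5")
    case True
    then have "(r, c) \<in> grid (12 + t) 5" "(r, c) \<in> grid 12 5" by (auto simp: grid_def)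
    then show ?thesis
      using lab_low[OF True] K0_entry_low[OF True] assms by auto
  next
    case False
    then have "(r, c) \<in> grid 12 5 \<longleftrightarrow> r = 12 \<and> 1 \<le> c \<and> c \<le> 5" by (auto simp: grid_def)
    moreover have high: "lab t (r, c) \<noteq> B j" if "12 \<le> r"
      unfolding lab_high[OF that] by simp
    ultimately show ?thesis
      using False row_12 high unfolding grid_K by auto
  qed
  then show ?thesis unfolding fibre_def K0_b_def set_eq_iff split_paired_All mem_Collect_eq by blast
qed

lemma fibre_One: "(r, c) \<in> grid (12 + t) 5 \<Longrightarrow> lab t (r, c) = One r' c' \<Longrightarrow> r' = r \<and> c' = c"
  unfolding grid_K using lab_low[of r c t] lab_high[of r t c] by (auto split: if_splits)

lemma lab_in_K_labels:
  assumes "(r, c) \<in> grid (12 + t) 5"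
  shows "lab t (r, c) = One r c \<or> lab t (r, c) \<in> K_labels t"
proof (cases "(r, c) \<in> grid 11 5")
  case True
  then show ?thesis
    using lab_low[OF True] K0_entry_low[OF True] by (auto simp: K_labels_def)
next
  case False
  then show ?thesis
    using assms lab_high[of r t c] unfolding grid_K by (auto simp: K_labels_def)
qed

lemma one_edges_K_explicit: "one_edges (K t) = {p \<in> grid 11 5. K0_entry p = 0} \<union> {12..12 + t} \<times> {5}"
proof (cases "t = 0")
  case True
  have 12: "K0_entry (12, c) = 0 \<longleftrightarrow> c = 5" if "1 \<le> c" "c \<le> 5" for c
  proof -
    have "c \<in> {1, 2, 3, 4, 5}" using that by auto
    then show ?thesis using K0_row_12 by auto
  qed
  have "(r, c) \<in> one_edges (K t) \<longleftrightarrow> (r, c) \<in> grid 12 5 \<and> K0_entry (r, c) = 0" for r c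
    using True by (simp add: K_def K0_def)
  moreover have "(r, c) \<in> grid 12 5 \<longleftrightarrow> (r, c) \<in> grid 11 5 \<or> r = 12 \<and> 1 \<le> c \<and> c \<le> 5" for r c
    by (auto simp: grid_def)
  ultimately show ?thesis using True 12 by auto
next
  case False
  have "{(11 + i, 5) | i. i \<in> {1..t}} \<union> {(12 + t, 5)} = {12..12 + t} \<times> {5::nat}"
  proof -
    have "r = 12 + t \<or> (\<exists>i\<in>{1..t}. r = 11 + i)" if "r \<in> {12..12 + t}" for r
    proof (cases "r = 12 + t")
      case False
      with that have "r = 11 + (r - 11)" "r - 11 \<in> {1..t}" by auto
      then show ?thesis by blast
    qed simp
    then show ?thesis by fastforce
  qed
  with False show ?thesis
    by (simp only: K_def if_False aug_config.select_convs Un_assoc)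
qed

lemma one_edges_K: "one_edges (K t) = {p \<in> grid (12 + t) 5. lab t p = One (fst p) (snd p)}"
proof -
  have "lab t (r, c) = One r c \<longleftrightarrow> K0_entry (r, c) = 0" if "(r, c) \<in> grid 11 5" for r c
    using lab_low[OF that] by auto
  moreover have "lab t (r, c) = One r c \<longleftrightarrow> c = 5" if "12 \<le> r" "1 \<le> c" "c \<le> 5" for r c
    using lab_high[OF that(1)] that by auto
  moreover have "12 \<le> r \<Longrightarrow> (r, c) \<notin> grid 11 5" for r c by (auto simp: grid_def)
  ultimately show ?thesis unfolding one_edges_K_explicit by (auto simp: grid_K)
qed

text \<open>
  For \<open>t = 0\<close> the four two-edges that meet row 12 of the seed are the chains \<open>P 0, P 1\<close> and \<open>Q 0, Q 1\<close>.
\<close>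

lemma two_edges_K: "two_edges (K t) = fibre t ` K_labels t"
proof -
  let ?J = "{1..19} - {10, 11, 14, 16::nat}"
  have "fibre t ` P ` {0..t + 1} = insert {(11, 1), (12 + t, 1)} (K_P ` {0..t})"
    using fibre_P[of _ t] by (auto simp: image_image atLeastAtMostSuc_conv)
  moreover have "fibre t ` Q ` {0..t + 1} = insert {(10, 1), (12 + t, 3)} (K_Q ` {0..t})"
    using fibre_Q[of _ t] by (auto simp: image_image atLeastAtMostSuc_conv)
  moreover have "fibre t ` B ` ?J = K0_b ` ?J"
    using fibre_B by (force simp: image_image)
  ultimately have *: "fibre t ` K_labels t = K0_b ` ?J \<union> insert {(11, 1), (12 + t, 1)} (K_P ` {0..t})
      \<union> insert {(10, 1), (12 + t, 3)} (K_Q ` {0..t})"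
    by (simp only: K_labels_def image_Un)
  show ?thesis
  proof (cases "t = 0")
    case True
    have "{1..19} = ?J \<union> {10, 11, 14, 16}" by auto
    then have "K0_b ` {1..19} = K0_b ` (?J \<union> {10, 11, 14, 16})" by (rule arg_cong)
    also have "\<dots> = K0_b ` ?J \<union> {K0_b 10, K0_b 11, K0_b 14, K0_b 16}"
      by (simp only: image_Un image_insert image_empty)
    also have "\<dots> = fibre t ` K_labels t"
      unfolding * K0_b_chain_ends using True by (auto simp: K_P_def K_Q_def)
    finally show ?thesis using True by (simp add: K_def K0_def)
  next
    case False
    then have "two_edges (K t) = K0_b ` ?J \<union> {{(11, 1), (12 + t, 1)}, {(10, 1), (12 + t, 3)}}
        \<union> K_P ` {0..t} \<union> K_Q ` {0..t}"
      by (simp only: K_def if_False aug_config.select_convs)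
    then show ?thesis unfolding * by (simp only: Un_insert_left Un_insert_right Un_assoc Un_empty_left Un_empty_right insert_commute)
  qed
qed

lemma card_fibre:
  assumes "l \<in> K_labels t"
  shows "card (fibre t l) = 2"
proof -
  have K0_b: "card (K0_b j) = 2" if "j \<in> {1..19} - {10, 11, 14, 16}" for j
  proof -
    have "list_all (\<lambda>j. length (filter (\<lambda>p. K0_entry p = j) (List.product [1..<13] [1..<6])) = 2) [1..<20]"
      by code_simp
    then have "length (filter (\<lambda>p. K0_entry p = j) (List.product [1..<13] [1..<6])) = 2"
      using that by (auto simp: list_all_iff)
    then show ?thesis
      unfolding K0_b_as_list by (subst distinct_card) (simp_all add: distinct_product)
  qed
  show ?thesis
    using assms unfolding K_labels_def
  proof (elim UnE imageE)
    fix j assume "l = B j" "j \<in> {1..19} - {10, 11, 14, 16}"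
    then show ?thesis using K0_b[of j] fibre_B[of j t] by simp
  next
    fix a assume "l = P a" "a \<in> {0..t + 1}"
    then show ?thesis using fibre_P[of a t] by (auto simp: K_P_def)
  next
    fix a assume "l = Q a" "a \<in> {0..t + 1}"
    then show ?thesis using fibre_Q[of a t] by (auto simp: K_Q_def)
  qed
qed

lemma augmented_K: "augmented (12 + t) 5 (K t)"
proof -
  have "one_edges (K t) \<inter> fibre t l = {}" if "l \<in> K_labels t" for l
    using that unfolding one_edges_K fibre_def K_labels_def by auto
  moreover have "fibre t l \<inter> fibre t l' = {}" if "fibre t l \<noteq> fibre t l'" for l l'
    using that by (auto simp: fibre_def)
  moreover have "one_edges (K t) \<subseteq> grid (12 + t) 5" "fibre t l \<subseteq> grid (12 + t) 5" for l
    by (auto simp: one_edges_K fibre_def)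
  ultimately show ?thesis
    unfolding augmented_def two_edges_K using card_fibre by auto
qed

lemma two_edge_iff_same_label:
  assumes "p \<in> grid (12 + t) 5" "q \<in> grid (12 + t) 5"
  shows "{p, q} \<in> two_edges (K t) \<longleftrightarrow> p \<noteq> q \<and> lab t p = lab t q"
proof
  assume e: "{p, q} \<in> two_edges (K t)"
  then obtain l where "fibre t l = {p, q}" unfolding two_edges_K by blast
  then have "p \<in> fibre t l" "q \<in> fibre t l" by simp_all
  then have "lab t p = lab t q" by (simp add: fibre_def)
  with two_edge_neq[OF augmented_K e] show "p \<noteq> q \<and> lab t p = lab t q" by simp
next
  assume *: "p \<noteq> q \<and> lab t p = lab t q"
  have "lab t p \<noteq> One (fst p) (snd p)"
    using * fibre_One[of "fst q" "snd q" t] assms(2) by (auto simp: prod_eq_iff)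
  then have l: "lab t p \<in> K_labels t"
    using lab_in_K_labels[of "fst p" "snd p" t] assms(1) by simp
  have sub: "{p, q} \<subseteq> fibre t (lab t p)" using * assms by (auto simp: fibre_def)
  have "finite (fibre t (lab t p))" by (simp add: fibre_def)
  then have "{p, q} = fibre t (lab t p)"
    using sub card_fibre[OF l] * by (intro card_seteq) auto
  then show "{p, q} \<in> two_edges (K t)" using l unfolding two_edges_K by blast
qed

lemma holes_K: "holes (12 + t) 5 (K t) = {}"
proof -
  have "p \<in> occupied (K t)" if "p \<in> grid (12 + t) 5" for p
    using that lab_in_K_labels[of "fst p" "snd p" t]
    by (auto simp: occupied_def one_edges_K two_edges_K fibre_def)
  then show ?thesis by (auto simp: holes_def)
qed

lemma K0_one_edges_low: "{p \<in> grid 11 5. K0_entry p = 0} = set (filter (\<lambda>p. K0_entry p = 0) (List.product [1..<12] [1..<6]))"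
  using grid_as_list[of 11 5] by auto

lemma card_one_edges_K: "card (one_edges (K t)) = t + 22"
proof -
  have "length (filter (\<lambda>p. K0_entry p = 0) (List.product [1..<12] [1..<6])) = 21" by code_simp
  then have "card {p \<in> grid 11 5. K0_entry p = 0} = 21"
    unfolding K0_one_edges_low by (subst distinct_card) (simp_all add: distinct_product)
  moreover have "card ({12..12 + t} \<times> {5::nat}) = t + 1" by (simp add: card_cartesian_product)
  moreover have "{p \<in> grid 11 5. K0_entry p = 0} \<inter> {12..12 + t} \<times> {5} = {}" by (auto simp: grid_def)
  ultimately show ?thesis
    unfolding one_edges_K_explicit by (subst card_Un_disjoint) auto
qed

text \<open>
  A row after the eleventh has a single one-edge, so only the fixed rows can contain a 4-cycle.
\<close>

lemma C4_free_one_edges_K: "C4_free (one_edges (K t))"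
proof -
  define L :: "cell list" where "L = filter (\<lambda>p. K0_entry p = 0) (List.product [1..<12] [1..<6])"
  have L: "L = [(1,1),(1,2),(2,1),(2,3),(3,1),(3,4),(4,1),(4,5),(5,2),(5,3),(6,2),(6,4),
      (7,2),(7,5),(8,3),(8,4),(9,3),(9,5),(10,4),(10,5),(11,4)]"
    unfolding L_def by code_simp
  have "list_all (\<lambda>(r, c). list_all (\<lambda>(r', d). r' = r \<and> d \<noteq> c \<longrightarrow>
      list_all (\<lambda>(s, c'). c' = c \<and> s \<noteq> r \<longrightarrow> (s, d) \<notin> set L) L) L) L"
    unfolding L by code_simp
  then have check: "(s, d) \<notin> set L"
    if "(r, c) \<in> set L" "(r, d) \<in> set L" "(s, c) \<in> set L" "d \<noteq> c" "s \<noteq> r" for r s c d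
    using that unfolding list_all_iff by fast
  have edge: "(r, c) \<in> one_edges (K t) \<longleftrightarrow> (r, c) \<in> set L \<and> r \<le> 11 \<or> r \<ge> 12 \<and> r \<le> 12 + t \<and> c = 5" for r c
    using K0_one_edges_low unfolding one_edges_K_explicit L_def by (auto simp: grid_def)
  show ?thesis
    unfolding C4_free_def
  proof
    assume "\<exists>r s c d. r \<noteq> s \<and> c \<noteq> d \<and> (r, c) \<in> one_edges (K t) \<and> (r, d) \<in> one_edges (K t)
      \<and> (s, c) \<in> one_edges (K t) \<and> (s, d) \<in> one_edges (K t)"
    then obtain r s c d where ne: "r \<noteq> s" "c \<noteq> d"
      and e: "(r, c) \<in> one_edges (K t)" "(r, d) \<in> one_edges (K t)"
        "(s, c) \<in> one_edges (K t)" "(s, d) \<in> one_edges (K t)"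
      by blast
    have "r \<le> 11" "s \<le> 11" using e ne(2) unfolding edge by linarith+
    then show False using check[of r c d s] e ne unfolding edge by simp
  qed
qed

section \<open>Certificates along the chains of two-edges\<close>

abbreviation known :: "nat \<Rightarrow> cell \<Rightarrow> cell \<Rightarrow> bool" where
  "known t \<equiv> decided (12 + t) 5 (K t)"

lemma known_grid: "known t p q \<Longrightarrow> p \<in> grid (12 + t) 5 \<and> q \<in> grid (12 + t) 5"
  using cert_sound(1,2)[OF augmented_K] unfolding decided_def by blast

lemmas known_sym = decided_sym[of "12 + t" 5 "K t" for t]
lemmas known_line = decided_line[of _ "12 + t" 5 _ "K t" for t]
lemmas known_rect = decided_rectangle[OF augmented_K]

lemma known_halves:
  assumes "known t p p'" "lab t p = lab t p'" "known t p q"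
  shows "known t p' q"
proof (cases "p = p'")
  case False
  then have "{p, p'} \<in> two_edges (K t)"
    using two_edge_iff_same_label known_grid[OF assms(1)] assms(2) by blast
  then show ?thesis using decided_halves[OF augmented_K] assms by blast
qed (use assms in simp)

lemma known_complementary:
  assumes "(r, c) \<in> grid (12 + t) 5" "(s, d) \<in> grid (12 + t) 5"
    and "lab t (r, c) = lab t (s, d)" "lab t (r, d) = lab t (s, c)"
  shows "known t (r, c) (s, d)"
proof (cases "r = s \<or> c = d")
  case True
  then show ?thesis using assms(1,2) by (intro known_line) auto
next
  case False
  have "(r, d) \<in> grid (12 + t) 5" "(s, c) \<in> grid (12 + t) 5" using assms(1,2) by (auto simp: grid_def)
  then show ?thesis
    using decided_complementary[OF augmented_K] two_edge_iff_same_label assms False by simp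
qed

text \<open>
  Labels are the right level of abstraction once the halves of the two-edges involved are identified: by
  \<open>known_labelsI\<close>, one known pair of representatives is then enough.
\<close>

definition known_labels :: "nat \<Rightarrow> label \<Rightarrow> label \<Rightarrow> bool" where
  "known_labels t l l' \<longleftrightarrow> (\<forall>p\<in>fibre t l. \<forall>q\<in>fibre t l'. known t p q)"

lemma known_labels_sym: "known_labels t l l' \<Longrightarrow> known_labels t l' l"
  unfolding known_labels_def using known_sym by blast

lemma known_labelsD:
  "known_labels t (lab t p) (lab t q) \<Longrightarrow> p \<in> grid (12 + t) 5 \<Longrightarrow> q \<in> grid (12 + t) 5 \<Longrightarrow> known t p q"
  unfolding known_labels_def fibre_def by blast

lemma known_labelsI:
  assumes "known_labels t (lab t p) (lab t p)" "known_labels t (lab t q) (lab t q)" "known t p q"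
  shows "known_labels t (lab t p) (lab t q)"
  unfolding known_labels_def
proof (intro ballI)
  fix p' q' assume p': "p' \<in> fibre t (lab t p)" and q': "q' \<in> fibre t (lab t q)"
  have "known t p p'" "known t q q'"
    using assms(1,2) p' q' known_grid[OF assms(3)] unfolding known_labels_def fibre_def by blast+
  then have "known t p' q"
    using known_halves[OF _ _ assms(3)] p' by (simp add: fibre_def)
  then have "known t q' p'"
    using known_halves[OF \<open>known t q q'\<close>, of p'] q' known_sym by (simp add: fibre_def)
  then show "known t p' q'" by (rule known_sym)
qed

lemma K0_entry_8_9: "K0_entry (10, 2) = 8" "K0_entry (11, 3) = 8" "K0_entry (10, 3) = 9" "K0_entry (11, 2) = 9"
  by code_simp+

lemma lab_8_9: "lab t (10, 2) = B 8" "lab t (11, 3) = B 8" "lab t (10, 3) = B 9" "lab t (11, 2) = B 9"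
  using K0_entry_8_9 by (simp_all add: lab_def)

lemma lab_ends: "lab t (9, 1) = P 0" "lab t (7, 3) = Q 0" "lab t (11, 1) = P (t + 1)" "lab t (10, 1) = Q (t + 1)"
  using K0_entry_ends by (simp_all add: lab_def)

lemma lab_chain:
  "1 \<le> a \<Longrightarrow> lab t (11 + a, 1) = P a" "lab t (12 + a, 2) = P a"
  "1 \<le> a \<Longrightarrow> lab t (11 + a, 3) = Q a" "lab t (12 + a, 4) = Q a"
  "1 \<le> a \<Longrightarrow> lab t (11 + a, 5) = One (11 + a) 5"
  by (simp_all add: lab_def)

lemma lab_w: "lab t (12 + t, 1) = P (t + 1)" "lab t (12 + t, 3) = Q (t + 1)"
  by (simp_all add: lab_def)

lemma known_b10: "known t (11, 1) (12 + t, 1)"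
  by (rule known_line) (auto simp: grid_def)

lemma known_b8: "known t (10, 2) (11, 3)" and known_b9: "known t (10, 3) (11, 2)"
  by (rule known_complementary; simp add: lab_8_9 grid_def)+

text \<open>
  The other diagonal of the rectangle spanned by \<open>b\<^bsub>11\<^esub>\<close> consists of a half of \<open>b\<^sub>9\<close> and a half of \<open>b\<^bsub>10\<^esub>\<close>, whose
  other halves share row 11.
\<close>

lemma known_b11: "known t (10, 1) (12 + t, 3)"
proof -
  have "known t (11, 1) (11, 2)" by (rule known_line) (auto simp: grid_def)
  then have "known t (12 + t, 1) (11, 2)"
    by (rule known_halves[OF known_b10, rotated]) (simp only: lab_ends lab_w)
  from known_halves[OF known_sym[OF known_b9] _ known_sym[OF this]]
  have "known t (10, 3) (12 + t, 1)" by (simp only: lab_8_9)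
  then show ?thesis by (rule known_rect)
qed

text \<open>
  The cell \<open>(w, 1)\<close> of the last row is a half of \<open>b\<^bsub>10\<^esub>\<close>. Two rectangles, using the identified two-edges
  \<open>b\<^bsub>10\<^esub>\<close>, \<open>b\<^sub>9\<close> and \<open>b\<^bsub>11\<^esub>\<close>, carry the pair to two cells of column 3.
\<close>

lemma known_column_2_w:
  assumes "1 \<le> r" "r \<le> 12 + t"
  shows "known t (r, 2) (12 + t, 1)"
proof -
  have "known t (12 + t, 3) (r, 3)" using assms by (intro known_line) (auto simp: grid_def)
  from known_halves[OF known_sym[OF known_b11] _ this]
  have "known t (10, 1) (r, 3)" by (simp only: lab_ends lab_w)
  from known_halves[OF known_b9 _ known_rect[OF this]]
  have "known t (11, 2) (r, 1)" by (simp only: lab_8_9)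
  from known_halves[OF known_b10 _ known_rect[OF this]]
  have "known t (12 + t, 1) (r, 2)" by (simp only: lab_ends lab_w)
  then show ?thesis by (rule known_sym)
qed

text \<open>
  The row of the half of \<open>P a\<close> that lies in column 1; the chain enters the fixed rows at \<open>(9, 1)\<close>.
\<close>

definition row_P :: "nat \<Rightarrow> nat" where "row_P a = (if a = 0 then 9 else 11 + a)"

text \<open>
  The row of the half of \<open>Q a\<close> that lies in column 3; the chain enters the fixed rows at \<open>(7, 3)\<close>.
\<close>

definition row_Q :: "nat \<Rightarrow> nat" where "row_Q a = (if a = 0 then 7 else 11 + a)"

lemma lab_row_P: "lab t (row_P a, 1) = P a" and lab_row_Q: "lab t (row_Q a, 3) = Q a"
  using lab_chain[of a t] lab_ends[of t] by (cases a; simp add: row_P_def row_Q_def)+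

lemma row_range: "a \<le> t + 1 \<Longrightarrow> 1 \<le> row_P a \<and> row_P a \<le> 12 + t" "a \<le> t + 1 \<Longrightarrow> 1 \<le> row_Q a \<and> row_Q a \<le> 12 + t"
  by (auto simp: row_P_def row_Q_def)

text \<open>
  The other diagonal of the rectangle spanned by \<open>P a\<close> consists of a cell of column 2 and a half of
  \<open>P (a + 1)\<close>. If the halves of \<open>P (a + 1)\<close> are identified, its half in column 2 can be used instead and the line
  rule applies. The descent starts at \<open>a = t\<close>: then \<open>P (t + 1)\<close> is \<open>b\<^bsub>10\<^esub>\<close>, which has no half in column 2 and is
  handled by \<open>known_column_2_w\<close>.
\<close>

lemma known_P:
  assumes "a \<le> t"
  shows "known t (row_P a, 1) (12 + a, 2)"
  using assms
proof (induction a rule: inc_induct)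
  case base
  show ?case using known_rect[OF known_column_2_w[of "row_P t" t]] row_range(1)[of t t] by simp
next
  case (step a)
  have "known t (12 + Suc a, 2) (row_P a, 2)"
    using row_range(1)[of a t] step.hyps by (intro known_line) (auto simp: grid_def)
  from known_halves[OF known_sym[OF step.IH] _ this]
  have "known t (row_P (Suc a), 1) (row_P a, 2)"
    using lab_chain(2)[of t "Suc a"] lab_row_P[of t "Suc a"] by simp
  then have "known t (12 + a, 1) (row_P a, 2)" by (simp add: row_P_def)
  then show ?case using known_rect known_sym by blast
qed

text \<open>
  This start of the descent for \<open>Q\<close> goes through \<open>P t\<close> and uses that its first half lies in the same row
  as that of \<open>Q t\<close>. This holds only for \<open>t \<ge> 1\<close>: in the seed the two halves lie in the rows 9 and 7.
\<close>

lemma known_Q_last: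
  assumes "1 \<le> t"
  shows "known t (11 + t, 3) (12 + t, 4)"
proof -
  have "known t (12 + t, 3) (12 + t, 4)" by (rule known_line) (auto simp: grid_def)
  from known_halves[OF known_sym[OF known_b11] _ this]
  have "known t (10, 1) (12 + t, 4)" by (simp only: lab_ends lab_w)
  from known_halves[OF known_sym[OF known_b10] _ known_sym[OF known_rect[OF this]]]
  have "known t (11, 1) (10, 4)" by (simp only: lab_ends lab_w)
  from known_halves[OF known_b11 _ known_sym[OF known_rect[OF this]]]
  have "known t (12 + t, 3) (11, 4)" by (simp only: lab_ends lab_w)
  from known_halves[OF known_sym[OF known_b8] _ known_sym[OF known_rect[OF this]]]
  have "known t (10, 2) (12 + t, 4)" by (simp only: lab_8_9)
  from known_halves[OF known_sym[OF known_P[OF order_refl]] _ known_sym[OF known_rect[OF this]]]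
  have "known t (row_P t, 1) (10, 4)" by (simp only: lab_row_P lab_chain)
  then have "known t (11 + t, 1) (10, 4)" using assms by (simp add: row_P_def)
  from known_halves[OF known_b11 _ known_sym[OF known_rect[OF this]]]
  have "known t (12 + t, 3) (11 + t, 4)" by (simp only: lab_ends lab_w)
  from known_rect[OF this] show ?thesis by (rule known_sym)
qed

lemma known_Q:
  assumes "1 \<le> t" "a \<le> t"
  shows "known t (row_Q a, 3) (12 + a, 4)"
  using assms(2)
proof (induction a rule: inc_induct)
  case base
  show ?case using known_Q_last[OF assms(1)] assms(1) by (simp add: row_Q_def)
next
  case (step a)
  have "known t (12 + Suc a, 4) (row_Q a, 4)"
    using row_range(2)[of a t] step.hyps by (intro known_line) (auto simp: grid_def)
  from known_halves[OF known_sym[OF step.IH] _ this]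
  have "known t (row_Q (Suc a), 3) (row_Q a, 4)"
    using lab_chain(4)[of t "Suc a"] lab_row_Q[of t "Suc a"] by simp
  then have "known t (12 + a, 3) (row_Q a, 4)" by (simp add: row_Q_def)
  then show ?case using known_rect known_sym by blast
qed

lemma known_pair: 
  assumes "known t p q" shows "\<forall>x\<in>{p, q}. \<forall>y\<in>{p, q}. known t x y"
  using known_grid[OF assms] assms known_sym known_line by blast

lemma fibre_P_row:
  assumes "a \<le> t + 1"
  shows "fibre t (P a) = {(row_P a, 1), if a = t + 1 then (11, 1) else (12 + a, 2)}"
  unfolding fibre_P[OF assms] by (auto simp: K_P_def row_P_def)

lemma fibre_Q_row:
  assumes "a \<le> t + 1"
  shows "fibre t (Q a) = {(row_Q a, 3), if a = t + 1 then (10, 1) else (12 + a, 4)}"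
  unfolding fibre_Q[OF assms] by (auto simp: K_Q_def row_Q_def)

lemma known_labels_P_self:
  assumes "a \<le> t + 1"
  shows "known_labels t (P a) (P a)"
proof -
  have "known t (row_P a, 1) (if a = t + 1 then (11, 1) else (12 + a, 2))"
    using known_P[of a t] known_sym[OF known_b10[of t]] assms by (auto simp: row_P_def)
  then show ?thesis
    unfolding known_labels_def fibre_P_row[OF assms] by (rule known_pair)
qed

lemma known_labels_Q_self:
  assumes "1 \<le> t" "a \<le> t + 1"
  shows "known_labels t (Q a) (Q a)"
proof -
  have "known t (row_Q a, 3) (if a = t + 1 then (10, 1) else (12 + a, 4))"
    using known_Q[OF assms(1), of a] known_sym[OF known_b11[of t]] assms by (auto simp: row_Q_def)
  then show ?thesis
    unfolding known_labels_def fibre_Q_row[OF assms(2)] by (rule known_pair)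
qed

lemma known_labels_One_self: "known_labels t (One r c) (One r c)"
proof -
  have "p = (r, c)" if "p \<in> fibre t (One r c)" for p
    using that fibre_One[of "fst p" "snd p" t r c] by (auto simp: fibre_def)
  then show ?thesis
    unfolding known_labels_def by (metis (no_types, lifting) fibre_def known_line mem_Collect_eq)
qed

text \<open>
  The rectangle through suitable representatives moves both indices towards each other by one, exchanging
  their order, which lowers their distance by two. At distance at most one the labels share a row.
\<close>

lemma known_labels_P_Q:
  assumes "1 \<le> t" "a \<le> t + 1" "b \<le> t + 1"
  shows "known_labels t (P a) (Q b)"
  using assms(2,3)
proof (induction "(a - b) + (b - a)" arbitrary: a b rule: less_induct)
  case less
  note P_self = known_labels_P_self[OF less.prems(1)] and Q_self = known_labels_Q_self[OF assms(1) less.prems(2)]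
  have by_cells: "known_labels t (P a) (Q b)" if "known t p q" "lab t p = P a" "lab t q = Q b" for p q
    using known_labelsI[OF _ _ that(1)] P_self Q_self that(2,3) by simp
  (* P 0 and Q 0 have no cells in a row 11 + 0; they meet in row 12. *)
  consider "a = 0" "b = 0" | "a = b" "1 \<le> a" | "a = b + 1" | "b = a + 1" | "a + 2 \<le> b" | "b + 2 \<le> a" by linarith
  then show ?case
  proof cases
    case 1
    show ?thesis
      by (rule by_cells[of "(12 + a, 2)" "(12 + b, 4)"], rule known_line) (use 1 in \<open>auto simp: lab_def grid_def\<close>)
  next
    case 2
    show ?thesis
      by (rule by_cells[of "(11 + a, 1)" "(11 + b, 3)"], rule known_line)
        (use 2 less.prems in \<open>auto simp: lab_def grid_def\<close>)
  next
    case 3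
    show ?thesis
      by (rule by_cells[of "(11 + a, 1)" "(12 + b, 4)"], rule known_line)
        (use 3 less.prems in \<open>auto simp: lab_def grid_def\<close>)
  next
    case 4
    show ?thesis
      by (rule by_cells[of "(12 + a, 2)" "(11 + b, 3)"], rule known_line)
        (use 4 less.prems in \<open>auto simp: lab_def grid_def\<close>)
  next
    case 5
    have "known_labels t (P (b - 1)) (Q (a + 1))" using 5 less.prems by (intro less.hyps) auto
    moreover have "lab t (11 + b, 2) = P (b - 1)" "lab t (12 + a, 3) = Q (a + 1)"
      using 5 by (auto simp: lab_def)
    ultimately have "known t (11 + b, 2) (12 + a, 3)"
      using 5 less.prems by (intro known_labelsD) (auto simp: grid_def)
    from known_sym[OF known_rect[OF this]] show ?thesis
      by (rule by_cells) (use 5 in \<open>auto simp: lab_def\<close>)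
  next
    case 6
    have "known_labels t (P (b + 1)) (Q (a - 1))" using 6 less.prems by (intro less.hyps) auto
    moreover have "lab t (12 + b, 1) = P (b + 1)" "lab t (11 + a, 4) = Q (a - 1)"
      using 6 by (auto simp: lab_def)
    ultimately have "known t (12 + b, 1) (11 + a, 4)"
      using 6 less.prems by (intro known_labelsD) (auto simp: grid_def)
    from known_sym[OF known_rect[OF this]] show ?thesis
      by (rule by_cells) (use 6 in \<open>auto simp: lab_def\<close>)
  qed
qed


text \<open>
  The same descent as for \<open>P\<close> against \<open>Q\<close>, stated for both chains at once. A one-edge has a single representative, so
  only one of the two index orders has a distance-decreasing rectangle; in the other order, the rectangle that
  exchanges the two indices comes first.
\<close>

lemma known_labels_One:
  fixes X :: "nat \<Rightarrow> label"
  assumes self: "\<And>a. a \<le> t + 1 \<Longrightarrow> known_labels t (X a) (X a)"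
    and cols: "c \<in> {1..5}" "c' \<in> {1..5}" 
    and lab: "\<And>a. 1 \<le> a \<Longrightarrow> lab t (11 + a, c) = X a" "\<And>a. lab t (12 + a, c') = X a"
    and ab: "a \<le> t + 1" "1 \<le> b" "b \<le> t + 1"
  shows "known_labels t (X a) (One (11 + b) 5)"
  using ab
proof (induction "(a - b) + (b - a)" arbitrary: a b rule: less_induct)
  case less
  have by_cells: "known_labels t (X a) (One (11 + b) 5)"
    if "known t p q" "a \<le> t + 1" "lab t p = X a" "lab t q = One (11 + b) 5" for p q a b
    using known_labelsI[OF _ _ that(1)] self[OF that(2)] known_labels_One_self that(3,4) by simp
  have U: "lab t (11 + b, 5) = One (11 + b) 5" if "1 \<le> b" for b using that by (simp add: lab_def)
  have swap: "known_labels t (X a) (One (11 + b) 5)"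
    if "known_labels t (X b) (One (11 + a) 5)" "1 \<le> a" "a \<le> t + 1" "1 \<le> b" "b \<le> t + 1" for a b
  proof -
    have "known t (11 + b, c) (11 + a, 5)"
      using that(1) lab(1)[OF that(4)] U[OF that(2)] that(2-5) cols by (intro known_labelsD) (auto simp: grid_def)
    from by_cells[OF known_sym[OF known_rect[OF this]]] show ?thesis
      using lab(1)[OF that(2)] U[OF that(4)] that(3) by simp
  qed
  have swap': "known_labels t (X a) (One (11 + b) 5)"
    if "known_labels t (X (b - 1)) (One (12 + a) 5)" "a \<le> t" "1 \<le> b" "b \<le> t + 1" for a b
  proof -
    have "lab t (11 + b, c') = X (b - 1)" using lab(2)[of "b - 1"] that(3) by simp
    then have "known t (11 + b, c') (12 + a, 5)"
      using that U[of "a + 1"] cols by (intro known_labelsD) (auto simp: grid_def)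
    from by_cells[OF known_sym[OF known_rect[OF this]]] show ?thesis
      using lab(2) U[OF that(3)] that(2) by simp
  qed
  have near: "known_labels t (X a) (One (11 + b) 5)" if "a = b \<or> a + 1 = b" "1 \<le> b" "b \<le> t + 1" for a b
  proof (cases "a = b")
    case True
    have "known t (11 + b, c) (11 + b, 5)" using that cols by (intro known_line) (auto simp: grid_def)
    from by_cells[OF this] show ?thesis using that True lab(1) U by simp
  next
    case False
    then have "known t (12 + a, c') (11 + b, 5)" using that cols by (intro known_line) (auto simp: grid_def)
    from by_cells[OF this] show ?thesis using that False lab(2) U by simp
  qed
  consider "a = b \<or> a + 1 = b" | "a + 2 \<le> b" | "a = b + 1" | "b + 2 \<le> a" by linarith
  then show ?case
  proof cases
    case 1
    then show ?thesis using near less.prems by blast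
  next
    case 2
    have "known_labels t (X (b - 1)) (One (11 + (a + 1)) 5)"
      using 2 less.prems by (intro less.hyps) auto
    then show ?thesis using 2 less.prems by (rule_tac swap') (auto simp: add.commute)
  next
    case 3
    then have "known_labels t (X b) (One (11 + a) 5)" using less.prems by (intro near) auto
    then show ?thesis using 3 less.prems by (rule_tac swap) auto
  next
    case 4
    have "known_labels t (X (a - 1)) (One (11 + (b + 1)) 5)"
      using 4 less.prems by (intro less.hyps) auto
    then have "known_labels t (X b) (One (11 + a) 5)"
      using 4 less.prems by (rule_tac swap') (auto simp: add.commute)
    then show ?thesis using 4 less.prems by (rule_tac swap) auto
  qed
qed

text \<open>
  The labels that occur in the rows from the twelfth on.
\<close>

definition chain_labels :: "nat \<Rightarrow> label set" where
  "chain_labels t = P ` {0..t + 1} \<union> Q ` {0..t + 1} \<union> (\<lambda>b. One (11 + b) 5) ` {1..t + 1}"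

lemma known_chain_labels:
  assumes t: "1 \<le> t" and l: "l \<in> chain_labels t" "l' \<in> chain_labels t"
  shows "known_labels t l l'"
proof -
  have PP: "known_labels t (P a) (P b)" if "a \<le> t + 1" "b \<le> t + 1" for a b
  proof -
    have "known t (row_P a, 1) (row_P b, 1)"
      using row_range(1) that by (intro known_line) (auto simp: grid_def)
    from known_labelsI[OF _ _ this, unfolded lab_row_P] show ?thesis
      using known_labels_P_self that by blast
  qed
  have QQ: "known_labels t (Q a) (Q b)" if "a \<le> t + 1" "b \<le> t + 1" for a b
  proof -
    have "known t (row_Q a, 3) (row_Q b, 3)"
      using row_range(2) that by (intro known_line) (auto simp: grid_def)
    from known_labelsI[OF _ _ this, unfolded lab_row_Q] show ?thesis
      using known_labels_Q_self t that by blast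
  qed
  have UU: "known_labels t (One (11 + a) 5) (One (11 + b) 5)" if "1 \<le> a" "a \<le> t + 1" "1 \<le> b" "b \<le> t + 1" for a b
  proof -
    have "known t (11 + a, 5) (11 + b, 5)"
      using that by (intro known_line) (auto simp: grid_def)
    from known_labelsI[OF _ _ this] show ?thesis
      using known_labels_One_self that by (simp add: lab_chain)
  qed
  have PQ: "known_labels t (P a) (Q b)" if "a \<le> t + 1" "b \<le> t + 1" for a b
    using known_labels_P_Q t that by blast
  have PU: "known_labels t (P a) (One (11 + b) 5)" if "a \<le> t + 1" "1 \<le> b" "b \<le> t + 1" for a b
    using that known_labels_P_self by (intro known_labels_One[where c = 1 and c' = 2]) (simp_all add: lab_def)
  have QU: "known_labels t (Q a) (One (11 + b) 5)" if "a \<le> t + 1" "1 \<le> b" "b \<le> t + 1" for a b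
    using that known_labels_Q_self[OF t] by (intro known_labels_One[where c = 3 and c' = 4]) (simp_all add: lab_def)
  from l show ?thesis
    unfolding chain_labels_def
    by (elim UnE imageE) (use PP QQ UU PQ PU QU known_labels_sym in \<open>simp_all\<close>)
qed

lemma lab_chain_row:
  assumes "12 \<le> r" "(r, c) \<in> grid (12 + t) 5"
  shows "lab t (r, c) \<in> chain_labels t"
proof -
  have r: "1 \<le> r - 11" "r - 11 \<le> t + 1" "r - 12 \<le> t + 1" "r = 11 + (r - 11)" "1 \<le> c" "c \<le> 5"
    using assms by (auto simp: grid_def)
  then consider "c = 1" | "c = 2" | "c = 3" | "c = 4" | "c = 5" by linarith
  then show ?thesis
  proof cases
    case 5
    then have "lab t (r, c) = One (11 + (r - 11)) 5" using assms(1) by (simp add: lab_high)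
    then show ?thesis using r unfolding chain_labels_def by force
  qed (use r assms(1) in \<open>auto simp: lab_high chain_labels_def\<close>)
qed

lemma known_chain:
  assumes "1 \<le> t" "p \<in> grid (12 + t) 5" "q \<in> grid (12 + t) 5"
    and "lab t p \<in> chain_labels t" "lab t q \<in> chain_labels t"
  shows "known t p q"
  using known_labelsD known_chain_labels assms by blast

section \<open>Closing a set of known pairs under the rules\<close>

type_synonym rect = "nat \<times> nat \<times> nat \<times> nat"
type_synonym table = "bool list list list list"

text \<open>
  Rules attached to a cell \<open>p\<close>. By \<open>Twin p'\<close>, the cell \<open>p\<close> may be replaced by \<open>p'\<close> once the pair \<open>p, p'\<close> is
  known. By \<open>Join b p'\<close>, whatever is known to both \<open>p\<close> and \<open>b\<close> is known to \<open>p'\<close>.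
\<close>

datatype rule = Twin cell | Join cell cell

text \<open>
  Within the closure computation rows and columns are counted from 0, so that they index lists directly.
\<close>

definition cells :: "cell list" where
  "cells = List.product [0..<12] [0..<5]"

text \<open>
  The two diagonals of a rectangle are known together, so a known pair is stored as the rectangle
  \<open>(r, s, c, d)\<close> with \<open>r \<le> s\<close> and \<open>c \<le> d\<close>; pairs on a common line give degenerate rectangles.
\<close>

fun rect_of :: "cell \<Rightarrow> cell \<Rightarrow> rect" where
  "rect_of (r, c) (s, d) = (min r s, max r s, min c d, max c d)"

text \<open>
  A triangular array in both coordinates: the entry of the rectangle \<open>(r, s, c, d)\<close> is found under \<open>s\<close>, \<open>r\<close>,
  \<open>d\<close>, \<open>c\<close>, where \<open>r \<le> s\<close> and \<open>c \<le> d\<close>.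
\<close>

definition table :: "bool \<Rightarrow> table" where
  "table b = map (\<lambda>s. replicate (Suc s) (map (\<lambda>d. replicate (Suc d) b) [0..<5])) [0..<12]"

fun marked :: "table \<Rightarrow> rect \<Rightarrow> bool" where
  "marked V (r, s, c, d) = V ! s ! r ! d ! c"

fun mark :: "table \<Rightarrow> rect \<Rightarrow> table" where
  "mark V (r, s, c, d) = V[s := (V ! s)[r := (V ! s ! r)[d := (V ! s ! r ! d)[c := True]]]]"

text \<open>
  Here and below, conditions are arguments of auxiliary functions with one equation for each truth value. A
  conditional expression would make the rewriting visit the whole state again whenever a condition is
  decided.
\<close>

fun guard :: "bool \<Rightarrow> 'a list \<Rightarrow> 'a list" where
  "guard True xs = xs"
| "guard False xs = []"

fun transfer :: "table \<Rightarrow> cell \<Rightarrow> cell \<Rightarrow> cell list \<Rightarrow> rect list" where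
  "transfer V p p' [] = []"
| "transfer V p p' (x # xs) = guard (marked V (rect_of p x)) [rect_of p' x] @ transfer V p p' xs"

text \<open>
  When the halves \<open>p, p'\<close> of a two-edge become a known pair, everything that was known to \<open>p\<close> before has to be
  passed on to \<open>p'\<close>.
\<close>

fun transfer_all :: "bool \<Rightarrow> table \<Rightarrow> cell \<Rightarrow> cell \<Rightarrow> rect list" where
  "transfer_all True V p p' = transfer V p p' cells"
| "transfer_all False V p p' = []"

fun consequences :: "table \<Rightarrow> cell \<Rightarrow> cell \<Rightarrow> rule list \<Rightarrow> rect list" where
  "consequences V p q [] = []"
| "consequences V p q (Twin p' # R) =
     guard (marked V (rect_of p p')) [rect_of p' q] @ transfer_all (q = p') V p p' @ consequences V p q R"
| "consequences V p q (Join b p' # R) =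
     guard (marked V (rect_of b q)) [rect_of p' q] @ consequences V p q R"

text \<open>
  The rules are grouped by cell once, so that each lookup follows two list indices.
\<close>

definition rule_table :: "(cell \<times> rule) list \<Rightarrow> rule list list list" where
  "rule_table R = map (\<lambda>r. map (\<lambda>c. map snd (filter (\<lambda>x. fst x = (r, c)) R)) [0..<5]) [0..<12]"

fun diagonal_consequences :: "rule list list list \<Rightarrow> table \<Rightarrow> cell \<Rightarrow> cell \<Rightarrow> rect list" where
  "diagonal_consequences A V (r, c) q = consequences V (r, c) q (A ! r ! c)"

fun rect_consequences :: "rule list list list \<Rightarrow> table \<Rightarrow> rect \<Rightarrow> rect list" where
  "rect_consequences A V (r, s, c, d) =
     diagonal_consequences A V (r, c) (s, d) @ diagonal_consequences A V (s, d) (r, c) @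
     diagonal_consequences A V (r, d) (s, c) @ diagonal_consequences A V (s, c) (r, d)"

fun push :: "rect list \<Rightarrow> table \<Rightarrow> rect list \<Rightarrow> table \<times> rect list"
  and push_unless :: "bool \<Rightarrow> rect \<Rightarrow> rect list \<Rightarrow> table \<Rightarrow> rect list \<Rightarrow> table \<times> rect list" where
  "push [] V F = (V, F)"
| "push (x # xs) V F = push_unless (marked V x) x xs V F"
| "push_unless True x xs V F = push xs V F"
| "push_unless False x xs V F = push xs (mark V x) (x # F)"

fun close_table :: "rule list list list \<Rightarrow> nat \<Rightarrow> table \<times> rect list \<Rightarrow> table" where
  "close_table A 0 (V, F) = V"
| "close_table A (Suc n) (V, []) = V"
| "close_table A (Suc n) (V, x # F) = close_table A n (push (rect_consequences A V x) V F)"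

definition line_rects :: "rect list" where
  "line_rects = concat (map (\<lambda>(r, c). map (\<lambda>s. rect_of (r, c) (s, c)) [0..<12] @ map (\<lambda>d. rect_of (r, c) (r, d)) [0..<5]) cells)"

text \<open>
  A worklist computation: each rectangle enters the list once, when it is marked. There are 78 times 15
  rectangles, so 1200 rounds empty the list.
\<close>

definition closure :: "(cell \<times> rule) list \<Rightarrow> rect list \<Rightarrow> table" where
  "closure R S = close_table (rule_table R) 1200 (push (S @ line_rects) (table False) [])"

definition twins :: "(cell \<times> cell) list \<Rightarrow> (cell \<times> rule) list" where
  "twins ps = concat (map (\<lambda>(p, q). [(p, Twin q), (q, Twin p)]) ps)"

text \<open>
  The two-edges with both halves in the first eleven rows; they are common to all \<open>K\<^sub>t\<close>.
\<close>

definition low_halves :: "(cell \<times> cell) list" where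
  "low_halves = [((0,2),(0,4)), ((0,3),(8,3)), ((1,1),(7,4)), ((1,4),(7,1)), ((1,3),(2,1)), ((2,2),(5,4)),
     ((2,4),(4,4)), ((3,1),(3,3)), ((3,2),(5,0)), ((4,0),(4,3)), ((5,2),(6,3)), ((6,0),(8,1)), ((7,0),(10,4)),
     ((9,1),(10,2)), ((9,2),(10,1))]"

text \<open>
  The rectangles whose two diagonals are two-edges: \<open>b\<^sub>5, b\<^sub>6\<close> and \<open>b\<^sub>8, b\<^sub>9\<close>.
\<close>

definition complementary_rects :: "rect list" where "complementary_rects = [rect_of (1,1) (7,4), rect_of (9,1) (10,2)]"

definition K0_rules :: "(cell \<times> rule) list" where
  "K0_rules = twins (low_halves @ [((10,0),(11,0)), ((9,0),(11,2)), ((8,0),(11,1)), ((6,2),(11,3))])"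

text \<open>
  Row 11 stands for all chain rows at once. Its columns 0 and 1 carry the labels \<open>P 1, ..., P (t + 1)\<close> and
  \<open>P 0, ..., P t\<close>, the cell \<open>(8, 0)\<close> carries \<open>P 0\<close> and \<open>(10, 0)\<close> carries \<open>P (t + 1)\<close>; likewise for \<open>Q\<close>. A rule in
  which both premises coincide passes from a column of the block to an end of the chain.
\<close>

definition chain_joins :: "(cell \<times> rule) list" where
  "chain_joins =
   [((11,0), Join (8,0) (11,1)), ((8,0), Join (11,0) (11,1)), ((11,1), Join (11,1) (8,0)),
    ((11,1), Join (10,0) (11,0)), ((10,0), Join (11,1) (11,0)), ((11,0), Join (11,0) (10,0)),
    ((11,2), Join (6,2) (11,3)), ((6,2), Join (11,2) (11,3)), ((11,3), Join (11,3) (6,2)),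
    ((11,3), Join (9,0) (11,2)), ((9,0), Join (11,3) (11,2)), ((11,2), Join (11,2) (9,0))]"

text \<open>
  The labels \<open>P 0\<close> and \<open>Q 0\<close> at \<open>(8, 0)\<close> and \<open>(6, 2)\<close> belong to the chains and are known to all of them.
\<close>

definition chain_rects :: "rect list" where
  "chain_rects = map (\<lambda>d. rect_of (8,0) (11,d)) [0..<5] @ map (\<lambda>d. rect_of (6,2) (11,d)) [0..<5]"

lemma set_cells: "set cells = {0..<12} \<times> {0..<5}"
  by (simp add: cells_def)

fun valid :: "rect \<Rightarrow> bool" where
  "valid (r, s, c, d) \<longleftrightarrow> r \<le> s \<and> s < 12 \<and> c \<le> d \<and> d < 5"

lemma valid_rect_of: "p \<in> set cells \<Longrightarrow> q \<in> set cells \<Longrightarrow> valid (rect_of p q)"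
  by (cases p; cases q) (auto simp: set_cells)

lemma marked_table: "valid x \<Longrightarrow> marked (table b) x = b"
  by (cases x) (simp add: table_def del: replicate_Suc)

lemma nth_list_update_cases: "xs[i := y] ! j = (if i = j \<and> i < length xs then y else xs ! j)"
  by (cases "i < length xs") (simp_all add: nth_list_update list_update_beyond)

lemma marked_mark: "marked (mark V y) x \<Longrightarrow> x = y \<or> marked V x"
  by (cases x; cases y) (auto simp: nth_list_update_cases split: if_splits)

lemma set_guard: "set (guard b xs) = (if b then set xs else {})"
  by (cases b) simp_all

text \<open>
  Soundness of the closure computation, for any relation on the cells that the rules respect.
\<close>

locale rectangle_closed =
  fixes kn :: "cell \<Rightarrow> cell \<Rightarrow> bool"
  assumes in_range: "kn p q \<Longrightarrow> p \<in> set cells"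
    and sym: "kn p q \<Longrightarrow> kn q p"
    and rect: "kn (r, c) (s, d) \<Longrightarrow> kn (r, d) (s, c)"
begin

fun holds :: "rect \<Rightarrow> bool" where
  "holds (r, s, c, d) \<longleftrightarrow> kn (r, c) (s, d)"

lemma holds_rect_of: "holds (rect_of p q) \<longleftrightarrow> kn p q"
proof -
  obtain r c s d where pq: "p = (r, c)" "q = (s, d)" by (metis surj_pair)
  have "kn (r, c) (s, d) \<longleftrightarrow> kn (s, d) (r, c)" "kn (r, c) (s, d) \<longleftrightarrow> kn (r, d) (s, c)"
    "kn (r, c) (s, d) \<longleftrightarrow> kn (s, c) (r, d)"
    using sym rect by blast+
  then show ?thesis
    by (cases "r \<le> s"; cases "c \<le> d") (simp_all add: pq min_def max_def)
qed

definition good :: "rect \<Rightarrow> bool" where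
  "good x \<longleftrightarrow> valid x \<and> holds x"

lemma good_rect_of: "kn p q \<Longrightarrow> good (rect_of p q)"
  using in_range sym valid_rect_of holds_rect_of unfolding good_def by blast

definition sound :: "table \<Rightarrow> bool" where
  "sound V \<longleftrightarrow> (\<forall>x. valid x \<longrightarrow> marked V x \<longrightarrow> holds x)"

lemma sound_marked:
  "sound V \<Longrightarrow> marked V (rect_of p q) \<Longrightarrow> p \<in> set cells \<Longrightarrow> q \<in> set cells \<Longrightarrow> kn p q"
  using valid_rect_of holds_rect_of unfolding sound_def by blast

fun rule_ok :: "cell \<Rightarrow> rule \<Rightarrow> bool" where
  "rule_ok p (Twin p') \<longleftrightarrow> p' \<in> set cells \<and> (\<forall>q. kn p p' \<longrightarrow> kn p q \<longrightarrow> kn p' q)"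
| "rule_ok p (Join b p') \<longleftrightarrow> b \<in> set cells \<and> (\<forall>q. kn p q \<longrightarrow> kn b q \<longrightarrow> kn p' q)"

lemma transfer_good:
  assumes "sound V" "p \<in> set cells" "kn p p'" "rule_ok p (Twin p')" "set xs \<subseteq> set cells"
  shows "\<forall>x\<in>set (transfer V p p' xs). good x"
  using assms(5)
proof (induction xs)
  case (Cons x xs)
  have "good (rect_of p' x)" if "marked V (rect_of p x)"
  proof (rule good_rect_of)
    have "kn p x" using sound_marked[OF assms(1) that assms(2)] Cons.prems by simp
    then show "kn p' x" using assms(3,4) unfolding rule_ok.simps by blast
  qed
  then show ?case using Cons by (auto simp: set_guard)
qed simp

lemma consequences_good:
  assumes "sound V" "kn p q" "\<forall>\<rho>\<in>set R. rule_ok p \<rho>"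
  shows "\<forall>x\<in>set (consequences V p q R). good x"
  using assms(3)
proof (induction R)
  case (Cons \<rho> R)
  have p: "p \<in> set cells" "q \<in> set cells" using assms(2) in_range sym by blast+
  show ?case
  proof (cases \<rho>)
    case (Twin p')
    then have ok: "rule_ok p (Twin p')" using Cons.prems by simp
    have "good (rect_of p' q)" if "marked V (rect_of p p')"
      using sound_marked[OF assms(1) that p(1)] ok assms(2)
      unfolding rule_ok.simps by (intro good_rect_of) blast
    moreover have "\<forall>x\<in>set (transfer_all (q = p') V p p'). good x"
      using transfer_good[OF assms(1) p(1) _ ok, of cells] assms(2) by (cases "q = p'") simp_all
    ultimately show ?thesis using Twin Cons by (auto simp: set_guard)
  next
    case (Join b p')
    then have ok: "rule_ok p (Join b p')" using Cons.prems by simp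
    have "good (rect_of p' q)" if "marked V (rect_of b q)"
      using sound_marked[OF assms(1) that _ p(2)] ok assms(2)
      unfolding rule_ok.simps by (intro good_rect_of) blast
    then show ?thesis using Join Cons by (auto simp: set_guard)
  qed
qed simp

context
  fixes R :: "(cell \<times> rule) list"
  assumes rules: "(p, \<rho>) \<in> set R \<Longrightarrow> rule_ok p \<rho>"
begin

lemma diagonal_consequences_good:
  assumes "sound V" "kn p q"
  shows "\<forall>x\<in>set (diagonal_consequences (rule_table R) V p q). good x"
proof -
  obtain r c where p: "p = (r, c)" by (metis surj_pair)
  then have "r < 12" "c < 5" using in_range[OF assms(2)] by (auto simp: set_cells)
  then have "rule_table R ! r ! c = map snd (filter (\<lambda>x. fst x = (r, c)) R)"
    by (simp add: rule_table_def)
  moreover have "\<forall>\<rho>\<in>set (map snd (filter (\<lambda>x. fst x = (r, c)) R)). rule_ok (r, c) \<rho>"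
    using rules by force
  ultimately show ?thesis
    using consequences_good[OF assms] unfolding p diagonal_consequences.simps by metis
qed

lemma rect_consequences_good:
  assumes "sound V" "good x"
  shows "\<forall>y\<in>set (rect_consequences (rule_table R) V x). good y"
proof -
  obtain r s c d where x: "x = (r, s, c, d)" by (metis surj_pair)
  have "kn (r, c) (s, d)" using assms(2) by (simp add: good_def x)
  with sym rect have "kn (r, c) (s, d)" "kn (s, d) (r, c)" "kn (r, d) (s, c)" "kn (s, c) (r, d)"
    by blast+
  then show ?thesis
    using diagonal_consequences_good[OF assms(1)] unfolding x rect_consequences.simps set_append by blast
qed

lemma push_good:
  "sound V \<Longrightarrow> \<forall>x\<in>set xs. good x \<Longrightarrow> \<forall>x\<in>set F. good x \<Longrightarrow>
    sound (fst (push xs V F)) \<and> (\<forall>x\<in>set (snd (push xs V F)). good x)"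
proof (induction xs arbitrary: V F)
  case (Cons x xs)
  have "sound (mark V x)"
    unfolding sound_def
  proof (intro allI impI)
    fix y assume y: "valid y" "marked (mark V x) y"
    have "holds x" using Cons.prems(2) by (simp add: good_def)
    moreover have "marked V y \<Longrightarrow> holds y" using Cons.prems(1) y(1) unfolding sound_def by blast
    ultimately show "holds y" using marked_mark[OF y(2)] by blast
  qed
  show ?case
  proof (cases "marked V x")
    case True
    then have "push (x # xs) V F = push xs V F" by simp
    with Cons.IH[of V F] Cons.prems show ?thesis by simp
  next
    case False
    then have "push (x # xs) V F = push xs (mark V x) (x # F)" by simp
    with Cons.IH[of "mark V x" "x # F"] Cons.prems \<open>sound (mark V x)\<close> show ?thesis by simp
  qed
qed simp

lemma close_table_sound:
  "sound V \<Longrightarrow> \<forall>x\<in>set F. good x \<Longrightarrow> sound (close_table (rule_table R) n (V, F))"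
proof (induction n arbitrary: V F)
  case (Suc n)
  show ?case
  proof (cases F)
    case (Cons x F')
    have "sound (fst (push (rect_consequences (rule_table R) V x) V F')) \<and>
        (\<forall>x\<in>set (snd (push (rect_consequences (rule_table R) V x) V F')). good x)"
      using Suc.prems rect_consequences_good[of V x] unfolding Cons by (intro push_good) auto
    then show ?thesis
      using Suc.IH unfolding Cons by (cases "push (rect_consequences (rule_table R) V x) V F'") simp
  qed (use Suc in simp)
qed simp

text \<open>
  All marked rectangles are known, hence a full table shows that every pair is known.
\<close>

theorem closure_complete:
  assumes lines: "\<And>p q. p \<in> set cells \<Longrightarrow> q \<in> set cells \<Longrightarrow> fst p = fst q \<or> snd p = snd q \<Longrightarrow> kn p q"
    and S: "\<And>x. x \<in> set S \<Longrightarrow> good x"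
    and full: "closure R S = table True"
    and pq: "p \<in> set cells" "q \<in> set cells"
  shows "kn p q"
proof -
  have "good x" if "x \<in> set line_rects" for x
    using that unfolding line_rects_def
    by (auto simp: set_cells simp del: rect_of.simps intro!: good_rect_of lines)
  then have all: "\<forall>x\<in>set (S @ line_rects). good x" using S by auto
  have "sound (table False)"
    unfolding sound_def
  proof (intro allI impI)
    fix x assume "valid x" "marked (table False) x"
    with marked_table[of x False] show "holds x" by blast
  qed
  moreover have "\<forall>x\<in>set []. good x" by simp
  ultimately have pushed: "sound (fst (push (S @ line_rects) (table False) []))"
    "\<forall>x\<in>set (snd (push (S @ line_rects) (table False) [])). good x"
    using push_good[OF _ all] by blast+
  have "sound (closure R S)"
    unfolding closure_def using close_table_sound[OF pushed] by (simp only: prod.collapse)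
  then show ?thesis
    unfolding full using sound_marked marked_table valid_rect_of pq by blast
qed

end

end

section \<open>Evaluating the two closures\<close>

text \<open>
  The evaluation works with unary numbers, for which comparison, minimum and list access are single
  structural recursions.
\<close>

lemma nat_unary:
  "(1::nat) = Suc 0" "(2::nat) = Suc (Suc 0)" "(3::nat) = Suc (Suc (Suc 0))" "(4::nat) = Suc (Suc (Suc (Suc 0)))"
  "(5::nat) = Suc (Suc (Suc (Suc (Suc 0))))" "(6::nat) = Suc (Suc (Suc (Suc (Suc (Suc 0)))))"
  "(7::nat) = Suc (Suc (Suc (Suc (Suc (Suc (Suc 0))))))" "(8::nat) = Suc (Suc (Suc (Suc (Suc (Suc (Suc (Suc 0)))))))"
  "(9::nat) = Suc (Suc (Suc (Suc (Suc (Suc (Suc (Suc (Suc 0))))))))"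
  "(10::nat) = Suc (Suc (Suc (Suc (Suc (Suc (Suc (Suc (Suc (Suc 0)))))))))"
  "(11::nat) = Suc (Suc (Suc (Suc (Suc (Suc (Suc (Suc (Suc (Suc (Suc 0))))))))))"
  by simp_all

lemma upt_5_12: "[0..<5] = [0, 1, 2, 3, 4]" "[0..<12] = [0, 1, 2, 3, 4, 5, 6, 7, 8, 9, 10, 11]"
  by (simp_all add: upt_conv_Cons)

lemmas upt_unary = upt_5_12[unfolded nat_unary]

lemma min_max_unary:
  "min 0 (n::nat) = 0" "min n (0::nat) = 0" "min (Suc m) (Suc n) = Suc (min m n)"
  "max 0 (n::nat) = n" "max n (0::nat) = n" "max (Suc m) (Suc n) = Suc (max m n)"
  by auto

lemma product_unary: "List.product [] ys = []" "List.product (x # xs) ys = map (Pair x) ys @ List.product xs ys"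
  by simp_all

lemma filter_cond: "filter A [] = []" "filter A (x # xs) = guard (A x) [x] @ filter A xs"
  by (cases "A x") simp_all

lemma close_table_numeral:
  "close_table A (numeral k) (V, []) = V"
  "close_table A (numeral k) (V, x # F) = close_table A (pred_numeral k) (push (rect_consequences A V x) V F)"
  by (simp_all add: numeral_eq_Suc)

lemmas evaluation = nat_unary upt_unary min_max_unary product_unary filter_cond
  list.map concat.simps append.simps append_Nil2 replicate.simps fst_conv snd_conv prod.case
  nat.inject nat.distinct prod.inject simp_thms nth_Cons_0 nth_Cons_Suc list_update_code
  rect_of.simps marked.simps mark.simps guard.simps transfer.simps transfer_all.simps consequences.simps
  diagonal_consequences.simps rect_consequences.simps push.simps push_unless.simps
  close_table_numeral pred_numeral_simps BitM.simps

lemma cells_eval: "cells = [(0, 0), (0, 1), (0, 2), (0, 3), (0, 4), (1, 0), (1, 1), (1, 2), (1, 3), (1, 4),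
  (2, 0), (2, 1), (2, 2), (2, 3), (2, 4), (3, 0), (3, 1), (3, 2), (3, 3), (3, 4),
  (4, 0), (4, 1), (4, 2), (4, 3), (4, 4), (5, 0), (5, 1), (5, 2), (5, 3), (5, 4),
  (6, 0), (6, 1), (6, 2), (6, 3), (6, 4), (7, 0), (7, 1), (7, 2), (7, 3), (7, 4),
  (8, 0), (8, 1), (8, 2), (8, 3), (8, 4), (9, 0), (9, 1), (9, 2), (9, 3), (9, 4),
  (10, 0), (10, 1), (10, 2), (10, 3), (10, 4), (11, 0), (11, 1), (11, 2), (11, 3), (11, 4)]"
  by (simp add: cells_def upt_5_12)

text \<open>
  The closure of the lines and complementary rectangles of the seed is everything. The halves of the two-edges
  are identified in the course of the computation.
\<close>

lemma closure_K0: "closure K0_rules complementary_rects = table True"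
  by (simp only: closure_def K0_rules_def low_halves_def twins_def complementary_rects_def line_rects_def cells_eval
    rule_table_def table_def evaluation)

text \<open>
  The closure for the block of all chain rows is everything as well, although row 11 is no longer linked to the
  fixed rows by two-edges but only by the weaker \<open>Join\<close> rules.
\<close>

lemma closure_chain: "closure (twins low_halves @ chain_joins) (complementary_rects @ chain_rects) = table True"
  by (simp only: closure_def low_halves_def twins_def chain_joins_def complementary_rects_def chain_rects_def line_rects_def cells_eval
    rule_table_def table_def evaluation)

section \<open>All pairs of cells are decided\<close>

text \<open>
  The cells of the grid that a cell of the twelve-row grid stands for: row 11 stands for all chain rows.
\<close>

definition block :: "nat \<Rightarrow> cell \<Rightarrow> cell set" where
  "block t p = (if fst p < 11 then {Suc (fst p)} else {12..12 + t}) \<times> {Suc (snd p)}"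

definition block_known :: "nat \<Rightarrow> cell \<Rightarrow> cell \<Rightarrow> bool" where
  "block_known t p q \<longleftrightarrow> p \<in> set cells \<and> q \<in> set cells \<and> (\<forall>x\<in>block t p. \<forall>y\<in>block t q. known t x y)"

lemma block_grid: "p \<in> set cells \<Longrightarrow> x \<in> block t p \<Longrightarrow> x \<in> grid (12 + t) 5"
  by (auto simp: block_def set_cells grid_def split: if_splits)

lemma in_block:
  assumes "(r, c) \<in> grid (12 + t) 5"
  shows "\<exists>p\<in>set cells. (r, c) \<in> block t p"
  using assms by (intro bexI[of _ "(min (r - 1) 11, c - 1)"]) (auto simp: block_def set_cells grid_def min_def)

interpretation block_known: rectangle_closed "block_known t" for t
proof
  show "p \<in> set cells" if "block_known t p q" for p q
    using that by (simp add: block_known_def)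
  show "block_known t q p" if "block_known t p q" for p q
    using that known_sym unfolding block_known_def by blast
  show "block_known t (r, d) (s, c)" if "block_known t (r, c) (s, d)" for r c s d
  proof -
    have "known t (x, Suc d) (y, Suc c)"
      if x: "(x, Suc d) \<in> block t (r, d)" and y: "(y, Suc c) \<in> block t (s, c)" for x y
    proof (rule known_rect)
      have "(x, Suc c) \<in> block t (r, c)" "(y, Suc d) \<in> block t (s, d)"
        using x y by (auto simp: block_def)
      then show "known t (x, Suc c) (y, Suc d)"
        using \<open>block_known t (r, c) (s, d)\<close> by (simp add: block_known_def)
    qed
    then show ?thesis
      using that by (auto simp: block_known_def set_cells block_def split: if_splits)
  qed
qed

text \<open>
  Two cells of row 11 stand for cells in possibly different rows, so in general the line rule covers them only if
  there is a single chain row.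
\<close>

lemma block_known_line:
  assumes "p \<in> set cells" "q \<in> set cells" "fst p = fst q \<or> snd p = snd q" and "t = 0 \<or> fst p \<noteq> 11 \<or> fst q \<noteq> 11"
  shows "block_known t p q"
  unfolding block_known_def
proof (intro conjI ballI assms(1,2))
  fix x y assume xy: "x \<in> block t p" "y \<in> block t q"
  have "fst x = fst y \<or> snd x = snd y"
    using assms xy by (auto simp: block_def set_cells split: if_splits)
  then show "known t x y"
    using block_grid assms(1,2) xy by (intro known_line) blast+
qed

lemma twin_ok:
  assumes "p' \<in> set cells" "\<forall>x'\<in>block t p'. \<exists>x\<in>block t p. lab t x = lab t x'"
  shows "block_known.rule_ok t p (Twin p')"
  unfolding block_known.rule_ok.simps
proof (intro conjI allI impI assms(1))
  fix q assume pp': "block_known t p p'" and pq: "block_known t p q"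
  show "block_known t p' q"
    unfolding block_known_def
  proof (intro conjI ballI assms(1))
    show "q \<in> set cells" using pq by (simp add: block_known_def)
    fix x' y assume "x' \<in> block t p'" "y \<in> block t q"
    then show "known t x' y"
      using assms(2) pp' pq known_halves unfolding block_known_def by meson
  qed
qed

text \<open>
  If \<open>q\<close> is known to two blocks that together contain every label of a third block, it is known to the third.
\<close>

lemma join_ok:
  assumes "b \<in> set cells" "p' \<in> set cells"
    and "\<forall>x'\<in>block t p'. \<exists>x\<in>block t p \<union> block t b. lab t x = lab t x' \<and> known t x x'"
  shows "block_known.rule_ok t p (Join b p')"
  unfolding block_known.rule_ok.simps
proof (intro conjI allI impI assms(1))
  fix q assume pq: "block_known t p q" and bq: "block_known t b q"
  show "block_known t p' q"
    unfolding block_known_def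
  proof (intro conjI ballI assms(2))
    show "q \<in> set cells" using pq by (simp add: block_known_def)
    fix x' y assume x': "x' \<in> block t p'" and y: "y \<in> block t q"
    then obtain x where x: "x \<in> block t p \<union> block t b" "lab t x = lab t x'" "known t x x'"
      using assms(3) by blast
    have "known t x y" using x(1) y pq bq unfolding block_known_def by blast
    then show "known t x' y" using known_halves x(2,3) by blast
  qed
qed

lemma low_halves_check:
  "list_all (\<lambda>((r, c), (s, d)). r < 11 \<and> c < 5 \<and> s < 11 \<and> d < 5 \<and> K0_entry (Suc r, Suc c) \<noteq> 0
     \<and> K0_entry (Suc r, Suc c) = K0_entry (Suc s, Suc d)) low_halves"
  by code_simp

lemma low_halves:
  assumes "(p, q) \<in> set low_halves"
  shows "p \<in> set cells" "q \<in> set cells" "block t p = {(Suc (fst p), Suc (snd p))}"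
    "block t q = {(Suc (fst q), Suc (snd q))}"
    "lab t (Suc (fst p), Suc (snd p)) = lab t (Suc (fst q), Suc (snd q))"
proof -
  obtain r c s d where pq: "p = (r, c)" "q = (s, d)" by (metis surj_pair)
  have *: "r < 11" "c < 5" "s < 11" "d < 5" "K0_entry (Suc r, Suc c) \<noteq> 0"
    "K0_entry (Suc r, Suc c) = K0_entry (Suc s, Suc d)"
    using bspec[OF low_halves_check[unfolded list_all_iff] assms] unfolding pq by simp_all
  then show "p \<in> set cells" "q \<in> set cells" "block t p = {(Suc (fst p), Suc (snd p))}"
    "block t q = {(Suc (fst q), Suc (snd q))}"
    by (auto simp: pq set_cells block_def)
  show "lab t (Suc (fst p), Suc (snd p)) = lab t (Suc (fst q), Suc (snd q))"
    using * by (simp add: pq lab_def Let_def)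
qed

lemma in_twins: "(p, \<rho>) \<in> set (twins ps) \<longleftrightarrow> (\<exists>q. \<rho> = Twin q \<and> ((p, q) \<in> set ps \<or> (q, p) \<in> set ps))"
proof (induction ps)
  case (Cons x ps)
  then show ?case by (cases x) (auto simp: twins_def)
qed (simp add: twins_def)

lemma low_halves_ok:
  assumes "(p, \<rho>) \<in> set (twins low_halves)"
  shows "block_known.rule_ok t p \<rho>"
proof -
  obtain a b where ab: "(a, b) \<in> set low_halves" and "p = a \<and> \<rho> = Twin b \<or> p = b \<and> \<rho> = Twin a"
    using assms unfolding in_twins by blast
  then show ?thesis
    using twin_ok[of b t a] twin_ok[of a t b] low_halves(1,2)[OF ab] low_halves(3-5)[OF ab, of t]
    by auto
qed

lemma K0_entry_5_6: "K0_entry (2, 2) = 5" "K0_entry (8, 5) = 5" "K0_entry (2, 5) = 6" "K0_entry (8, 2) = 6"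
  by code_simp+

lemma complementary_rects_good:
  assumes "x \<in> set complementary_rects"
  shows "block_known.good t x"
proof -
  have "known t (2, 2) (8, 5)"
    by (rule known_complementary) (simp_all add: grid_def lab_def K0_entry_5_6)
  moreover have "block t (1, 1) = {(2, 2)}" "block t (7, 4) = {(8, 5)}"
    "block t (9, 1) = {(10, 2)}" "block t (10, 2) = {(11, 3)}"
    by (simp_all add: block_def numeral_eq_Suc)
  moreover have "{(1, 1), (7, 4), (9, 1), (10, 2)} \<subseteq> set cells" by (simp add: set_cells)
  ultimately have "block_known t (1, 1) (7, 4)" "block_known t (9, 1) (10, 2)"
    using known_b8[of t] unfolding block_known_def by simp_all
  then show ?thesis
    using assms block_known.good_rect_of[of t "(1, 1)" "(7, 4)"] block_known.good_rect_of[of t "(9, 1)" "(10, 2)"]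
    by (auto simp: complementary_rects_def simp del: rect_of.simps)
qed

lemma join_chain_ok:
  assumes "1 \<le> t" "b \<in> set cells" "p' \<in> set cells"
    and "\<And>x'. x' \<in> block t p' \<Longrightarrow> lab t x' \<in> chain_labels t \<and> (\<exists>x\<in>block t p \<union> block t b. lab t x = lab t x')"
    and "p \<in> set cells"
  shows "block_known.rule_ok t p (Join b p')"
proof (intro join_ok assms(2,3) ballI)
  fix x' assume x': "x' \<in> block t p'"
  then obtain x where x: "x \<in> block t p \<union> block t b" "lab t x = lab t x'" using assms(4) by blast
  have "x \<in> grid (12 + t) 5" "x' \<in> grid (12 + t) 5" using x(1) x' block_grid assms(2,3,5) by blast+
  then have "known t x x'" using known_chain[OF assms(1)] assms(4)[OF x'] x(2) by simp
  with x show "\<exists>x\<in>block t p \<union> block t b. lab t x = lab t x' \<and> known t x x'" by blast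
qed

lemma block_chain:
  "block t (11, 0) = (\<lambda>a. (12 + a, 1)) ` {0..t}" "block t (11, 1) = (\<lambda>a. (12 + a, 2)) ` {0..t}"
  "block t (11, 2) = (\<lambda>a. (12 + a, 3)) ` {0..t}" "block t (11, 3) = (\<lambda>a. (12 + a, 4)) ` {0..t}"
  "block t (8, 0) = {(9, 1)}" "block t (6, 2) = {(7, 3)}" "block t (10, 0) = {(11, 1)}" "block t (9, 0) = {(10, 1)}"
proof -
  have "{12..12 + t} \<times> {c} = (\<lambda>a. (12 + a, c)) ` {0..t}" for c :: nat
  proof -
    have shift: "{12..12 + t} = (\<lambda>a. 12 + a) ` {0..t}" by (simp add: image_add_atLeastAtMost)
    have "{12..12 + t} \<times> {c} = (\<lambda>r. (r, c)) ` {12..12 + t}" by auto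
    also have "\<dots> = (\<lambda>r. (r, c)) ` (\<lambda>a. 12 + a) ` {0..t}"
      by (subst shift) (rule refl)
    finally show ?thesis by (simp only: image_image)
  qed
  then show "block t (11, 0) = (\<lambda>a. (12 + a, 1)) ` {0..t}" "block t (11, 1) = (\<lambda>a. (12 + a, 2)) ` {0..t}"
    "block t (11, 2) = (\<lambda>a. (12 + a, 3)) ` {0..t}" "block t (11, 3) = (\<lambda>a. (12 + a, 4)) ` {0..t}"
    by (simp_all add: block_def numeral_eq_Suc)
qed (simp_all add: block_def numeral_eq_Suc)

lemma lab_block:
  "lab t ` block t (11, 0) = P ` {1..t + 1}" "lab t ` block t (11, 1) = P ` {0..t}"
  "lab t ` block t (11, 2) = Q ` {1..t + 1}" "lab t ` block t (11, 3) = Q ` {0..t}"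
  "lab t ` block t (8, 0) = {P 0}" "lab t ` block t (6, 2) = {Q 0}"
  "lab t ` block t (10, 0) = {P (t + 1)}" "lab t ` block t (9, 0) = {Q (t + 1)}"
proof -
  have shift: "{1..t + 1} = Suc ` {0..t}" by simp
  show "lab t ` block t (11, 0) = P ` {1..t + 1}" "lab t ` block t (11, 2) = Q ` {1..t + 1}"
    unfolding block_chain shift image_image by (simp_all add: lab_def)
  show "lab t ` block t (11, 1) = P ` {0..t}" "lab t ` block t (11, 3) = Q ` {0..t}"
    unfolding block_chain image_image by (simp_all only: lab_chain)
qed (use lab_ends[of t] in \<open>simp_all add: block_chain\<close>)

theorem known_K0:
  assumes "p \<in> grid 12 5" "q \<in> grid 12 5"
  shows "known 0 p q"
proof -
  have rules: "block_known.rule_ok 0 p \<rho>" if rule: "(p, \<rho>) \<in> set K0_rules" for p \<rho>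
  proof (cases "(p, \<rho>) \<in> set (twins low_halves)")
    case True
    then show ?thesis by (rule low_halves_ok)
  next
    case False
    define ends :: "(cell \<times> cell) list" where
      "ends = [((10,0),(11,0)), ((9,0),(11,2)), ((8,0),(11,1)), ((6,2),(11,3))]"
    obtain a b where ab: "(a, b) \<in> set ends" "p = a \<and> \<rho> = Twin b \<or> p = b \<and> \<rho> = Twin a"
      using rule False unfolding K0_rules_def ends_def[symmetric] in_twins set_append by blast
    have "a \<in> set cells \<and> b \<in> set cells \<and> lab 0 ` block 0 a = lab 0 ` block 0 b"
      using ab(1) unfolding ends_def list.set insert_iff prod.inject empty_iff
      by (elim disjE conjE FalseE) (simp_all only: lab_block, simp_all add: set_cells block_chain)
    then have ab': "a \<in> set cells" "b \<in> set cells" "lab 0 ` block 0 a = lab 0 ` block 0 b"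
      by blast+
    have cover: "\<forall>y\<in>Y. \<exists>x\<in>X. lab 0 x = lab 0 y" if "lab 0 ` X = lab 0 ` Y" for X Y
    proof
      fix y assume "y \<in> Y"
      then have "lab 0 y \<in> lab 0 ` X" using that by simp
      then show "\<exists>x\<in>X. lab 0 x = lab 0 y" by (metis imageE)
    qed
    have "block_known.rule_ok 0 a (Twin b)" "block_known.rule_ok 0 b (Twin a)"
      using twin_ok[OF ab'(2) cover[OF ab'(3)]] twin_ok[OF ab'(1) cover[OF ab'(3)[symmetric]]] .
    then show ?thesis using ab(2) by blast
  qed
  have "block_known 0 p q" if "p \<in> set cells" "q \<in> set cells" for p q
    using block_known.closure_complete[where t = 0, OF rules _ _ closure_K0] block_known_line complementary_rects_good that by blast
  moreover obtain p' q' where "p' \<in> set cells" "p \<in> block 0 p'" "q' \<in> set cells" "q \<in> block 0 q'"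
    using in_block[of "fst p" "snd p" 0] in_block[of "fst q" "snd q" 0] assms by auto
  ultimately show ?thesis unfolding block_known_def by blast
qed

lemma chain_joins_ok:
  assumes "1 \<le> t" "(p, \<rho>) \<in> set chain_joins"
  shows "block_known.rule_ok t p \<rho>"
proof -
  have ok: "block_known.rule_ok t p (Join b p')"
    if "p \<in> set cells" "b \<in> set cells" "p' \<in> set cells"
      "lab t ` block t p' \<subseteq> chain_labels t" "lab t ` block t p' \<subseteq> lab t ` block t p \<union> lab t ` block t b" for p b p'
  proof (rule join_chain_ok[OF assms(1) that(2,3) _ that(1)])
    fix x' assume "x' \<in> block t p'"
    then have "lab t x' \<in> lab t ` block t p'" by blast
    then show "lab t x' \<in> chain_labels t \<and> (\<exists>x\<in>block t p \<union> block t b. lab t x = lab t x')"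
      using that(4,5) by (metis Un_iff image_Un imageE subsetD)
  qed
  have chain: "P ` {1..t + 1} \<subseteq> chain_labels t" "P ` {0..t} \<subseteq> chain_labels t" "Q ` {1..t + 1} \<subseteq> chain_labels t"
    "Q ` {0..t} \<subseteq> chain_labels t" "{P 0} \<subseteq> chain_labels t" "{Q 0} \<subseteq> chain_labels t" "{P (t + 1)} \<subseteq> chain_labels t"
    "{Q (t + 1)} \<subseteq> chain_labels t"
    by (auto simp: chain_labels_def)
  have cells: "(11, 0) \<in> set cells" "(11, 1) \<in> set cells" "(11, 2) \<in> set cells" "(11, 3) \<in> set cells"
    "(8, 0) \<in> set cells" "(6, 2) \<in> set cells" "(10, 0) \<in> set cells" "(9, 0) \<in> set cells"
    by (simp_all add: set_cells)
  have P_cover: "P ` {0..t} \<subseteq> P ` {1..t + 1} \<union> {P 0}" "P ` {0..t} \<subseteq> {P 0} \<union> P ` {1..t + 1}"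
    "{P 0} \<subseteq> P ` {0..t} \<union> P ` {0..t}" "P ` {1..t + 1} \<subseteq> P ` {0..t} \<union> {P (t + 1)}"
    "P ` {1..t + 1} \<subseteq> {P (t + 1)} \<union> P ` {0..t}" "{P (t + 1)} \<subseteq> P ` {1..t + 1} \<union> P ` {1..t + 1}"
    by auto
  have Q_cover: "Q ` {0..t} \<subseteq> Q ` {1..t + 1} \<union> {Q 0}" "Q ` {0..t} \<subseteq> {Q 0} \<union> Q ` {1..t + 1}"
    "{Q 0} \<subseteq> Q ` {0..t} \<union> Q ` {0..t}" "Q ` {1..t + 1} \<subseteq> Q ` {0..t} \<union> {Q (t + 1)}"
    "Q ` {1..t + 1} \<subseteq> {Q (t + 1)} \<union> Q ` {0..t}" "{Q (t + 1)} \<subseteq> Q ` {1..t + 1} \<union> Q ` {1..t + 1}"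
    by auto
  have "\<forall>(p, \<rho>)\<in>set chain_joins. block_known.rule_ok t p \<rho>"
    unfolding chain_joins_def list.set ball_simps prod.case
    by (intro conjI TrueI; rule ok; (rule cells)?; unfold lab_block; rule chain P_cover Q_cover)
  then show ?thesis using assms(2) by blast
qed

text \<open>
  All labels involved are chain labels, so these pairs are known by the descent on indices.
\<close>

lemma block_known_chain:
  assumes "1 \<le> t" "p \<in> {(8, 0), (6, 2)} \<union> {11} \<times> {0..<5}" "d < 5"
  shows "block_known t p (11, d)"
  unfolding block_known_def
proof (intro conjI ballI)
  show p: "p \<in> set cells" "(11, d) \<in> set cells" using assms by (auto simp: set_cells)
  fix x y assume x: "x \<in> block t p" and y: "y \<in> block t (11, d)"
  have y': "lab t y \<in> chain_labels t"
    using y block_grid[OF p(2) y] by (auto simp: block_def intro: lab_chain_row)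
  have x': "lab t x \<in> chain_labels t"
  proof (cases "fst p = 11")
    case True
    then show ?thesis using x block_grid[OF p(1) x] by (auto simp: block_def intro: lab_chain_row)
  next
    case False
    then have "x = (9, 1) \<or> x = (7, 3)" using x assms(2) by (auto simp: block_def)
    then show ?thesis using lab_ends[of t] by (auto simp: chain_labels_def)
  qed
  show "known t x y" using known_chain[OF assms(1)] x' y' block_grid x y p by blast
qed

theorem known_K_pos:
  assumes "1 \<le> t" "p \<in> grid (12 + t) 5" "q \<in> grid (12 + t) 5"
  shows "known t p q"
proof -
  have rules: "block_known.rule_ok t p \<rho>" if "(p, \<rho>) \<in> set (twins low_halves @ chain_joins)" for p \<rho>
    using that low_halves_ok chain_joins_ok[OF assms(1)] unfolding set_append by blast
  have complementary_rects: "block_known.good t x" if x: "x \<in> set (complementary_rects @ chain_rects)" for x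
  proof (cases "x \<in> set complementary_rects")
    case True
    then show ?thesis by (rule complementary_rects_good)
  next
    case False
    then obtain p d where "x = rect_of p (11, d)" "p \<in> {(8, 0), (6, 2)}" "d < 5"
      using x unfolding chain_rects_def by (auto simp del: rect_of.simps)
    then show ?thesis
      using block_known.good_rect_of[OF block_known_chain[OF assms(1), of p d]] by blast
  qed
  have lines: "block_known t p q" if "p \<in> set cells" "q \<in> set cells" "fst p = fst q \<or> snd p = snd q" for p q
  proof (cases "fst p = 11 \<and> fst q = 11")
    case True
    then show ?thesis using block_known_chain[OF assms(1), of p "snd q"] that(1,2) by (cases p; cases q) (auto simp: set_cells)
  next
    case False
    then show ?thesis using block_known_line that by blast
  qed
  have "block_known t p q" if "p \<in> set cells" "q \<in> set cells" for p q
    using block_known.closure_complete[where t = t, OF rules lines complementary_rects closure_chain] that by blast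
  moreover obtain p' q' where "p' \<in> set cells" "p \<in> block t p'" "q' \<in> set cells" "q \<in> block t q'"
    using in_block[of "fst p" "snd p" t] in_block[of "fst q" "snd q" t] assms by auto
  ultimately show ?thesis unfolding block_known_def by blast
qed


theorem K_decided: "p \<in> grid (12 + t) 5 \<Longrightarrow> q \<in> grid (12 + t) 5 \<Longrightarrow> known t p q"
  using known_K0 known_K_pos by (cases "t = 0") simp_all

lemma zarankiewicz_5:
  assumes "12 \<le> m"
  shows "zarankiewicz m 5 = m + 10"
proof -
  let ?A = "{card E | E. E \<subseteq> grid m 5 \<and> C4_free E}"
  obtain t where m: "m = 12 + t" using assms le_Suc_ex by blast
  have le: "x \<le> m + 10" if "x \<in> ?A" for x
    using that C4_free_card_le[of _ m 5] by (auto simp: choose_two)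
  have "?A \<subseteq> {..m + 10}" using le by blast
  then have "finite ?A" by (rule finite_subset) simp
  moreover have "m + 10 \<in> ?A"
  proof -
    have "one_edges (K t) \<subseteq> grid m 5" using augmented_K[of t] by (simp add: augmented_def m)
    moreover have "card (one_edges (K t)) = m + 10" by (simp add: card_one_edges_K m)
    ultimately show ?thesis
      using C4_free_one_edges_K by (intro CollectI exI[of _ "one_edges (K t)"]) simp
  qed
  ultimately show ?thesis unfolding zarankiewicz_def using le by (intro Max_eqI) blast+
qed

theorem theorem5p4:
  fixes m :: nat
  assumes "m \<ge> 12"
  shows "z_RL m 5 = 3 * m + 5
    \<and> simple_config m 5 (K (m - 12))
    \<and> limited m 5 (K (m - 12))
    \<and> RW3_plus m 5 (K (m - 12))
    \<and> card (one_edges (K (m - 12))) + card (two_edges (K (m - 12))) = 3 * m + 5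
    \<and> card (one_edges (K (m - 12))) = m + 10
    \<and> card (two_edges (K (m - 12))) = 2 * m - 5
    \<and> card (holes m 5 (K (m - 12))) = 0"
proof -
  define t where "t = m - 12"
  have m: "m = 12 + t" using assms by (simp add: t_def)
  have one: "card (one_edges (K t)) = m + 10" by (simp add: card_one_edges_K m)
  have aug: "augmented m 5 (K t)" using augmented_K by (simp add: m)
  have holes: "holes m 5 (K t) = {}" using holes_K by (simp add: m)
  have two: "card (two_edges (K t)) = 2 * m - 5"
    using count_cells[OF aug] one by (simp add: holes)
  have simple: "simple_config m 5 (K t)"
    using aug C4_free_one_edges_K by (simp add: simple_config_def)
  have lim: "limited m 5 (K t)" using one assms by (simp add: limited_def zarankiewicz_5)
  have rw3: "RW3_plus m 5 (K t)"
    using RW3_plus_if_decided[OF aug] K_decided[of _ t] by (simp add: m)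
  have total: "card (one_edges (K t)) + card (two_edges (K t)) = 3 * m + 5"
    using one two assms by simp
  let ?A = "{card (one_edges C) + card (two_edges C) | C.
     simple_config m 5 C \<and> limited m 5 C \<and> RW3_plus m 5 C}"
  have le: "x \<le> 3 * m + 5" if x: "x \<in> ?A" for x
  proof -
    obtain C where C: "x = card (one_edges C) + card (two_edges C)" "simple_config m 5 C" "limited m 5 C"
      using x by blast
    then have "augmented m 5 C" "card (one_edges C) = m + 10"
      using assms by (simp_all add: simple_config_def limited_def zarankiewicz_5)
    then show ?thesis using count_cells[of m 5 C] C(1) by simp
  qed
  then have "?A \<subseteq> {..3 * m + 5}" by blast
  then have "finite ?A" by (rule finite_subset) simp
  moreover have "3 * m + 5 \<in> ?A"
    using simple lim rw3 total by (intro CollectI exI[of _ "K t"]) simp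
  ultimately have "z_RL m 5 = 3 * m + 5"
    unfolding z_RL_def using le by (intro Max_eqI) blast+
  then show ?thesis
    using simple lim rw3 total one two holes unfolding t_def[symmetric] by simp
qed

end
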